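(* Let $\mathcal{A}$ be an operator algebra, $\rho:\mathcal{A}\to B(\mathcal{H})$ a representation, and $\theta:\mathrm{C}^*_{max}(\mathcal{A})\to B(\mathcal{H})$ the $*$-representation with $\theta\circ\mu=\rho$. Then $\rho$ is $*$-RFD if and only if $\theta$ is an RFD $*$-representation.
   Context: An operator algebra is a subalgebra of $B(\mathcal{H})$; a representation is a completely contractive algebra homomorphism. The maximal $\mathrm{C}^*$-cover $(\mathrm{C}^*_{max}(\mathcal{A}),\mu)$: $\mu$ is a completely isometric representation with $\mathrm{C}^*_{max}(\mathcal{A})=\mathrm{C}^*(\mu(\mathcal{A}))$ such that every representation $\rho$ of $\mathcal{A}$ lifts to a unique $*$-representation $\theta$ with $\theta\circ\mu=\rho$. A representation $\rho:\mathcal{A}\to B(\mathcal{H})$ is $*$-RFD if there is a net of representations $\rho_\lambda:\mathcal{A}\to B(\mathcal{H})$ with $\mathrm{C}^*(\rho_\lambda(\mathcal{A}))\mathcal{H}$ finite-dimensional, $\rho_\lambda(a)\to\rho(a)$ and $\rho_\lambda(a)^*\to\rho(a)^*$ strongly for all $a\in\mathcal{A}$. A $*$-representation $\pi$ of a $\mathrm{C}^*$-algebra $\mathfrak{A}$ on $\mathcal{H}$ is an RFD $*$-representation if there is a net of (possibly degenerate) $*$-representations $\pi_\lambda:\mathfrak{A}\to B(\mathcal{H})$ with $\pi_\lambda(\mathfrak{A})\mathcal{H}$ finite-dimensional and $\pi_\lambda(t)\to\pi(t)$ strongly for every $t\in\mathfrak{A}$. *)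

theory Defs
  imports "HOL-Analysis.Analysis"
begin

class complex_inner = real_normed_vector +
  fixes scaleC :: "complex \<Rightarrow> 'a \<Rightarrow> 'a" (infixr \<open>*\<^sub>C\<close> 75)
    and cinner :: "'a \<Rightarrow> 'a \<Rightarrow> complex"
  assumes scaleC_add_right: "a *\<^sub>C (x + y) = a *\<^sub>C x + a *\<^sub>C y"
    and scaleC_add_left: "(a + b) *\<^sub>C x = a *\<^sub>C x + b *\<^sub>C x"
    and scaleC_scaleC: "a *\<^sub>C (b *\<^sub>C x) = (a * b) *\<^sub>C x"
    and scaleC_one: "1 *\<^sub>C x = x"
    and scaleC_of_real: "complex_of_real r *\<^sub>C x = r *\<^sub>R x"
    and cinner_commute: "cinner x y = cnj (cinner y x)"
    and cinner_add_right: "cinner x (y + z) = cinner x y + cinner x z"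
    and cinner_scaleC_right: "cinner x (c *\<^sub>C y) = c * cinner x y"
    and cinner_self: "cinner x x = complex_of_real ((norm x)\<^sup>2)"

class chilbert_space = complex_inner + complete_space

definition clinear :: "('a::complex_inner \<Rightarrow> 'b::complex_inner) \<Rightarrow> bool" where
  "clinear T \<longleftrightarrow> (\<forall>x y. T (x + y) = T x + T y) \<and> (\<forall>c x. T (c *\<^sub>C x) = c *\<^sub>C T x)"

definition bdd_op :: "('a::complex_inner \<Rightarrow> 'a) \<Rightarrow> bool" where
  "bdd_op T \<longleftrightarrow> clinear T \<and> (\<exists>K. \<forall>x. norm (T x) \<le> K * norm x)"

definition adj :: "('a::complex_inner \<Rightarrow> 'a) \<Rightarrow> 'a \<Rightarrow> 'a" where
  "adj T y = (THE z. \<forall>x. cinner z x = cinner y (T x))"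

definition op_add :: "('a::complex_inner \<Rightarrow> 'a) \<Rightarrow> ('a \<Rightarrow> 'a) \<Rightarrow> 'a \<Rightarrow> 'a" where
  "op_add S T = (\<lambda>x. S x + T x)"

definition op_scale :: "complex \<Rightarrow> ('a::complex_inner \<Rightarrow> 'a) \<Rightarrow> 'a \<Rightarrow> 'a" where
  "op_scale c T = (\<lambda>x. c *\<^sub>C T x)"

definition op_algebra :: "('a::complex_inner \<Rightarrow> 'a) set \<Rightarrow> bool" where
  "op_algebra A \<longleftrightarrow> A \<subseteq> Collect bdd_op \<and> (\<lambda>x. 0) \<in> A
     \<and> (\<forall>S\<in>A. \<forall>T\<in>A. op_add S T \<in> A \<and> S \<circ> T \<in> A)
     \<and> (\<forall>c. \<forall>T\<in>A. op_scale c T \<in> A)"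

definition mat_norm :: "nat \<Rightarrow> (nat \<Rightarrow> nat \<Rightarrow> ('a::complex_inner \<Rightarrow> 'a)) \<Rightarrow> real" where
  "mat_norm n M = Sup {sqrt (\<Sum>i<n. (norm (\<Sum>j<n. M i j (x j)))\<^sup>2) | x.
                        (\<Sum>j<n. (norm (x j))\<^sup>2) \<le> 1}"

definition norm_closed :: "('a::complex_inner \<Rightarrow> 'a) set \<Rightarrow> bool" where
  "norm_closed B \<longleftrightarrow> (\<forall>T. bdd_op T \<and> (\<forall>e>0. \<exists>S\<in>B. onorm (\<lambda>x. T x - S x) < e) \<longrightarrow> T \<in> B)"

definition cstar_subalg :: "('a::complex_inner \<Rightarrow> 'a) set \<Rightarrow> bool" where
  "cstar_subalg B \<longleftrightarrow> op_algebra B \<and> (\<forall>T\<in>B. adj T \<in> B) \<and> norm_closed B"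

definition cstar_gen :: "('a::complex_inner \<Rightarrow> 'a) set \<Rightarrow> ('a \<Rightarrow> 'a) set" where
  "cstar_gen S = \<Inter>{B. cstar_subalg B \<and> S \<subseteq> B}"

definition cspan :: "'a::complex_inner set \<Rightarrow> 'a set" where
  "cspan F = {\<Sum>x\<in>F. c x *\<^sub>C x | c. True}"

text \<open>\<open>S H\<close> (closed linear span of \<open>{T h. T \<in> S, h \<in> H}\<close>) is finite-dimensional.\<close>
definition fin_dim_range :: "('a::complex_inner \<Rightarrow> 'a) set \<Rightarrow> bool" where
  "fin_dim_range S \<longleftrightarrow> (\<exists>F. finite F \<and> (\<forall>T\<in>S. \<forall>h. T h \<in> cspan F))"

definition alg_hom ::
  "('a::complex_inner \<Rightarrow> 'a) set \<Rightarrow> (('a \<Rightarrow> 'a) \<Rightarrow> ('b::complex_inner \<Rightarrow> 'b)) \<Rightarrow> bool" where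
  "alg_hom A \<rho> \<longleftrightarrow> (\<forall>S\<in>A. \<forall>T\<in>A. \<rho> (op_add S T) = op_add (\<rho> S) (\<rho> T)
                                 \<and> \<rho> (S \<circ> T) = \<rho> S \<circ> \<rho> T)
                   \<and> (\<forall>c. \<forall>T\<in>A. \<rho> (op_scale c T) = op_scale c (\<rho> T))"

definition representation ::
  "('a::complex_inner \<Rightarrow> 'a) set \<Rightarrow> (('a \<Rightarrow> 'a) \<Rightarrow> ('b::complex_inner \<Rightarrow> 'b)) \<Rightarrow> bool" where
  "representation A \<rho> \<longleftrightarrow> alg_hom A \<rho> \<and> (\<forall>T\<in>A. bdd_op (\<rho> T))
     \<and> (\<forall>n M. (\<forall>i<n. \<forall>j<n. M i j \<in> A) \<longrightarrow> mat_norm n (\<lambda>i j. \<rho> (M i j)) \<le> mat_norm n M)"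

definition compl_isometric_rep ::
  "('a::complex_inner \<Rightarrow> 'a) set \<Rightarrow> (('a \<Rightarrow> 'a) \<Rightarrow> ('b::complex_inner \<Rightarrow> 'b)) \<Rightarrow> bool" where
  "compl_isometric_rep A \<rho> \<longleftrightarrow> alg_hom A \<rho> \<and> (\<forall>T\<in>A. bdd_op (\<rho> T))
     \<and> (\<forall>n M. (\<forall>i<n. \<forall>j<n. M i j \<in> A) \<longrightarrow> mat_norm n (\<lambda>i j. \<rho> (M i j)) = mat_norm n M)"

text \<open>*-representation of a (concrete) C*-algebra \<open>C \<subseteq> B(K)\<close> on \<open>H\<close> (possibly degenerate).\<close>
definition star_rep ::
  "('a::complex_inner \<Rightarrow> 'a) set \<Rightarrow> (('a \<Rightarrow> 'a) \<Rightarrow> ('b::complex_inner \<Rightarrow> 'b)) \<Rightarrow> bool" where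
  "star_rep C \<theta> \<longleftrightarrow> alg_hom C \<theta> \<and> (\<forall>T\<in>C. bdd_op (\<theta> T)) \<and> (\<forall>T\<in>C. \<theta> (adj T) = adj (\<theta> T))"

text \<open>Maximal C*-cover \<open>(C, \<mu>)\<close> of \<open>A\<close>, with \<open>C\<close> realised concretely inside \<open>B(K')\<close>.
  The universal property is asserted for representations on Hilbert spaces of type \<open>'h\<close>.\<close>
definition max_cstar_cover ::
  "('a::complex_inner \<Rightarrow> 'a) set \<Rightarrow> ('c::complex_inner \<Rightarrow> 'c) set \<Rightarrow> (('a \<Rightarrow> 'a) \<Rightarrow> ('c \<Rightarrow> 'c))
     \<Rightarrow> 'h::complex_inner itself \<Rightarrow> bool" where
  "max_cstar_cover A C \<mu> _ \<longleftrightarrow> compl_isometric_rep A \<mu> \<and> C = cstar_gen (\<mu> ` A)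
     \<and> (\<forall>\<rho> :: ('a \<Rightarrow> 'a) \<Rightarrow> ('h \<Rightarrow> 'h). representation A \<rho> \<longrightarrow>
          (\<exists>\<theta>. star_rep C \<theta> \<and> (\<forall>T\<in>A. \<theta> (\<mu> T) = \<rho> T))
        \<and> (\<forall>\<theta>1 \<theta>2. star_rep C \<theta>1 \<and> star_rep C \<theta>2 \<and> (\<forall>T\<in>A. \<theta>1 (\<mu> T) = \<rho> T)
              \<and> (\<forall>T\<in>A. \<theta>2 (\<mu> T) = \<rho> T) \<longrightarrow> (\<forall>S\<in>C. \<theta>1 S = \<theta>2 S)))"

text \<open>Nets are rendered as proper filters on the space of maps (the filter of tails of the net).\<close>
definition star_RFD ::
  "('a::complex_inner \<Rightarrow> 'a) set \<Rightarrow> (('a \<Rightarrow> 'a) \<Rightarrow> ('b::complex_inner \<Rightarrow> 'b)) \<Rightarrow> bool" where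
  "star_RFD A \<rho> \<longleftrightarrow> (\<exists>F :: (('a \<Rightarrow> 'a) \<Rightarrow> ('b \<Rightarrow> 'b)) filter. F \<noteq> bot
     \<and> eventually (\<lambda>r. representation A r \<and> fin_dim_range (cstar_gen (r ` A))) F
     \<and> (\<forall>T\<in>A. \<forall>h. ((\<lambda>r. r T h) \<longlongrightarrow> \<rho> T h) F
                 \<and> ((\<lambda>r. adj (r T) h) \<longlongrightarrow> adj (\<rho> T) h) F))"

definition RFD_star_rep ::
  "('a::complex_inner \<Rightarrow> 'a) set \<Rightarrow> (('a \<Rightarrow> 'a) \<Rightarrow> ('b::complex_inner \<Rightarrow> 'b)) \<Rightarrow> bool" where
  "RFD_star_rep C \<pi> \<longleftrightarrow> (\<exists>F :: (('a \<Rightarrow> 'a) \<Rightarrow> ('b \<Rightarrow> 'b)) filter. F \<noteq> bot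
     \<and> eventually (\<lambda>p. star_rep C p \<and> fin_dim_range (p ` C)) F
     \<and> (\<forall>T\<in>C. \<forall>h. ((\<lambda>p. p T h) \<longlongrightarrow> \<pi> T h) F))"

end

theory Submission
  imports Defs
begin

text \<open>Lifting to \<open>C\<^sup>*\<^sub>m\<^sub>a\<^sub>x\<close> and restricting along \<open>\<mu>\<close> translate the two kinds of approximating nets into
  each other. The point is that a *-representation of a C*-algebra is automatically completely
  contractive. For one thing, restrictions along \<open>\<mu>\<close> are therefore representations. For another,
  the elements on which the lifted net converges *-strongly form a C*-algebra, which contains
  \<open>\<mu>(A)\<close> and hence is everything; likewise the lift of \<open>r\<close> takes values in the C*-algebra
  generated by \<open>r(A)\<close>.\<close>

section \<open>Complex inner product spaces\<close>

text \<open>The analytic core is complete contractivity. Spectral arguments take place in the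
  unitization of the n by n matrices over \<open>C\<close>; since \<open>C\<close> may lack a unit
  and \<open>\<theta>\<close> may be degenerate, the square root is arranged so that no identity
  operator has to belong to the algebra. The self-adjoint matrix b = 1 - (1 - a)^(1/2) is a norm
  limit of polynomials in a without constant term, so its entries lie in \<open>C\<close>. It
  satisfies an algebraic equation, which any homomorphism preserves; hence no continuity of
  \<open>\<theta>\<close> is presupposed in proving that \<open>\<theta>\<close> is contractive.
  Norm below 1 makes the approximation geometric, and scaling removes the strictness. Contractivity
  must hold with one constant along the whole net: strong limits respect products only on bounded
  sets, and norm limits need uniform estimates. Adjoints are not strongly continuous, so convergence
  is tracked at an element and at its adjoint; \<open>star_RFD\<close> supplies both on the
  generators, while for \<open>RFD_star_rep\<close> the second follows because \<open>C\<close> is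
  self-adjoint.\<close>

lemma cinner_add_left: "cinner (x + y) z = cinner x z + cinner (y::'a::complex_inner) z"
  by (metis cinner_commute cinner_add_right complex_cnj_add)

lemma cinner_scaleC_left: "cinner (c *\<^sub>C x) y = cnj c * cinner x (y::'a::complex_inner)"
  by (metis cinner_commute cinner_scaleC_right complex_cnj_mult)

lemma cinner_scaleR_right: "cinner x (r *\<^sub>R y) = r *\<^sub>R cinner x (y::'a::complex_inner)"
  by (metis cinner_scaleC_right scaleC_of_real scaleR_conv_of_real)

lemma cinner_scaleR_left: "cinner (r *\<^sub>R x) y = r *\<^sub>R cinner x (y::'a::complex_inner)"
  by (metis cinner_scaleC_left complex_cnj_complex_of_real scaleC_of_real scaleR_conv_of_real)

lemma cinner_diff_right: "cinner x (y - z) = cinner x y - cinner x (z::'a::complex_inner)"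
  by (metis add_diff_cancel_right' cinner_add_right diff_add_cancel)

lemma cinner_zero_right [simp]: "cinner x (0::'a::complex_inner) = 0"
  by (metis add_cancel_left_left cinner_add_right)

lemma norm_sq_cinner: "(norm (x::'a::complex_inner))\<^sup>2 = Re (cinner x x)"
  by (simp add: cinner_self)

lemma Re_cinner_commute: "Re (cinner x (y::'a::complex_inner)) = Re (cinner y x)"
  by (subst cinner_commute) simp

lemma norm_add_sq:
  "(norm (x + y))\<^sup>2 = (norm x)\<^sup>2 + 2 * Re (cinner x y) + (norm (y::'a::complex_inner))\<^sup>2"
  using Re_cinner_commute[of x y]
  by (simp add: norm_sq_cinner cinner_add_left cinner_add_right)

lemma norm_scaleC: "norm (c *\<^sub>C (x::'a::complex_inner)) = cmod c * norm x"
proof -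
  have "complex_of_real ((norm (c *\<^sub>C x))\<^sup>2) = (cnj c * c) * cinner x x"
    by (simp add: cinner_self[symmetric] cinner_scaleC_left cinner_scaleC_right del: of_real_power)
  also have "\<dots> = complex_of_real ((cmod c * norm x)\<^sup>2)"
    by (metis cinner_self complex_norm_square mult.commute of_real_mult power_mult_distrib)
  finally have "(norm (c *\<^sub>C x))\<^sup>2 = (cmod c * norm x)\<^sup>2"
    using of_real_eq_iff by blast
  then show ?thesis
    by (rule power2_eq_imp_eq) auto
qed

lemma Cauchy_Schwarz_cinner: "cmod (cinner x y) \<le> norm x * norm (y::'a::complex_inner)"
proof (cases "y = 0")
  case False
  \<comment> \<open>This coefficient makes \<open>x + c *\<^sub>C y\<close> orthogonal to
    \<open>y\<close>, so the squared length below is the Pythagorean remainder of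
    \<open>x\<close>.\<close>
  define c where "c = - (cinner y x / of_real ((norm y)\<^sup>2))"
  have ny: "(norm y)\<^sup>2 \<noteq> 0" using False by simp
  have xy: "cinner x y = cnj (cinner y x)" by (rule cinner_commute)
  have "0 \<le> (norm (x + c *\<^sub>C y))\<^sup>2" by simp
  also have "\<dots> = (norm x)\<^sup>2 + 2 * Re (c * cinner x y) + (cmod c * norm y)\<^sup>2"
    by (simp add: norm_add_sq norm_scaleC cinner_scaleC_right)
  also have "c * cinner x y = - of_real ((cmod (cinner y x))\<^sup>2 / (norm y)\<^sup>2)"
    by (simp add: c_def xy complex_norm_square del: of_real_power)
  also have "(cmod c * norm y)\<^sup>2 = (cmod (cinner y x))\<^sup>2 / (norm y)\<^sup>2"
    using ny by (simp add: c_def norm_divide norm_power power_divide power2_eq_square del: of_real_mult)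
  finally have "(cmod (cinner y x))\<^sup>2 / (norm y)\<^sup>2 \<le> (norm x)\<^sup>2" by simp
  then have "(cmod (cinner y x))\<^sup>2 \<le> (norm x * norm y)\<^sup>2"
    using ny by (simp add: divide_simps power_mult_distrib)
  then have "cmod (cinner y x) \<le> norm x * norm y"
    by (rule power2_le_imp_le) simp
  then show ?thesis by (simp add: xy)
qed simp

interpretation cinner: bounded_bilinear cinner
proof
  show "\<exists>K. \<forall>a b. norm (cinner (a::'a) b) \<le> norm a * norm b * K"
    using Cauchy_Schwarz_cinner by (intro exI[of _ 1]) auto
qed (auto simp: cinner_add_left cinner_add_right cinner_scaleR_left cinner_scaleR_right)

lemma bounded_linear_scaleC: "bounded_linear (\<lambda>x::'a::complex_inner. c *\<^sub>C x)"
proof (rule bounded_linear_intro[of _ "cmod c"])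
  show "c *\<^sub>C (r *\<^sub>R x) = r *\<^sub>R (c *\<^sub>C x)" for r and x :: 'a
    by (metis scaleC_of_real scaleC_scaleC mult.commute)
qed (auto simp: scaleC_add_right norm_scaleC)

lemmas scaleC_sum_right = bounded_linear.linear[OF bounded_linear_scaleC, THEN linear_sum]

lemma scaleC_minus1: "(-1) *\<^sub>C x = - (x::'a::complex_inner)"
  using scaleC_of_real[of "-1" x] by simp

lemma scaleC_zero_left [simp]: "0 *\<^sub>C x = (0::'a::complex_inner)"
  using scaleC_of_real[of 0 x] by simp

lemma cinner_eqI:
  assumes "\<And>x. cinner z x = cinner w (x::'a::complex_inner)"
  shows "z = w"
proof -
  have "cinner (z - w) (z - w) = 0"
    by (simp only: cinner.diff_left assms) simp
  then show ?thesis by (simp add: cinner_self)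
qed

section \<open>Bounded operators and adjoints\<close>

lemma bdd_op_add: "bdd_op T \<Longrightarrow> T (x + y) = T x + T y"
  and bdd_op_scaleC: "bdd_op T \<Longrightarrow> T (c *\<^sub>C x) = c *\<^sub>C T x"
  by (simp_all add: bdd_op_def clinear_def)

text \<open>Bridge to the real theory: sums, differences, limits and \<open>onorm\<close> are all
  handled through \<open>bounded_linear\<close>.\<close>

lemma bdd_op_bounded_linear: "bounded_linear T" if T: "bdd_op T"
proof -
  obtain K where "\<And>x. norm (T x) \<le> K * norm x"
    using T by (auto simp: bdd_op_def)
  moreover have "T (r *\<^sub>R x) = r *\<^sub>R T x" for r x
    by (metis bdd_op_scaleC scaleC_of_real that)
  ultimately show ?thesis
    by (intro bounded_linear_intro[of _ K]) (auto simp: bdd_op_add[OF that] mult.commute)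
qed

lemmas bdd_op_zero = bdd_op_bounded_linear[THEN bounded_linear.linear, THEN linear_0]
  and bdd_op_diff = bdd_op_bounded_linear[THEN bounded_linear.linear, THEN linear_diff]
  and bdd_op_sum = bdd_op_bounded_linear[THEN bounded_linear.linear, THEN linear_sum]
  and bdd_op_scaleR = bdd_op_bounded_linear[THEN bounded_linear.linear, THEN linear_scale]

lemma bdd_opI:
  assumes "\<And>x y. T (x + y) = T x + T y" "\<And>c x. T (c *\<^sub>C x) = c *\<^sub>C T x"
    and "\<And>x. norm (T x) \<le> K * norm x"
  shows "bdd_op T"
  using assms unfolding bdd_op_def clinear_def by blast

lemma bdd_op_bound: "bdd_op T \<Longrightarrow> \<exists>K>0. \<forall>x. norm (T x) \<le> K * norm x"
  using bounded_linear.pos_bounded[OF bdd_op_bounded_linear] by (metis mult.commute)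

lemma bdd_op_const_zero: "bdd_op (\<lambda>x. 0)"
  by (rule bdd_opI[of _ 0])
     (auto simp: bounded_linear.linear[OF bounded_linear_scaleC, THEN linear_0])

lemma bdd_op_op_add: "bdd_op (op_add S T)" if ST: "bdd_op S" "bdd_op T"
proof -
  obtain K L where K: "\<And>x. norm (S x) \<le> K * norm x" and L: "\<And>x. norm (T x) \<le> L * norm x"
    using ST by (metis bdd_op_bound)
  have "norm (S x + T x) \<le> (K + L) * norm x" for x
    using norm_triangle_ineq[of "S x" "T x"] K[of x] L[of x] by (simp add: algebra_simps)
  then show ?thesis
    using that
    by (intro bdd_opI[of _ "K + L"]) (auto simp: op_add_def bdd_op_add bdd_op_scaleC scaleC_add_right)
qed

lemma bdd_op_op_scale: "bdd_op (op_scale c T)" if T: "bdd_op T"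
proof -
  obtain K where K: "\<And>x. norm (T x) \<le> K * norm x" using T by (metis bdd_op_bound)
  have "norm (c *\<^sub>C T x) \<le> (cmod c * K) * norm x" for x
    using mult_left_mono[OF K[of x], of "cmod c"] by (simp add: norm_scaleC mult.assoc)
  then show ?thesis
    using that
    by (intro bdd_opI[of _ "cmod c * K"])
       (auto simp: op_scale_def bdd_op_add bdd_op_scaleC scaleC_add_right scaleC_scaleC mult.commute)
qed

lemma bdd_op_comp: "bdd_op (S \<circ> T)" if ST: "bdd_op S" "bdd_op T"
proof -
  obtain K L where K: "K > 0" "\<And>x. norm (S x) \<le> K * norm x" and L: "\<And>x. norm (T x) \<le> L * norm x"
    using ST by (metis bdd_op_bound)
  have "norm (S (T x)) \<le> (K * L) * norm x" for x
    using order_trans[OF K(2) mult_left_mono[OF L less_imp_le[OF K(1)]]] by (simp add: mult.assoc)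
  then show ?thesis
    using ST by (intro bdd_opI[of _ "K * L"]) (auto simp: bdd_op_add bdd_op_scaleC)
qed

text \<open>The representing vector minimises \<open>\<parallel>x\<parallel>\<^sup>2 - 2 Re (f x)\<close>; minimising sequences are Cauchy
  by the parallelogram law.\<close>

lemma Riesz_representation:
  fixes f :: "'a::chilbert_space \<Rightarrow> complex"
  assumes add: "\<And>x y. f (x + y) = f x + f y" and scale: "\<And>c x. f (c *\<^sub>C x) = c * f x"
    and bound: "\<And>x. cmod (f x) \<le> K * norm x"
  shows "\<exists>z. \<forall>x. cinner z x = f x"
proof -
  define J where "J x = (norm x)\<^sup>2 - 2 * Re (f x)" for x
  define d where "d = Inf (range J)"
  have scaleR: "f (r *\<^sub>R x) = r *\<^sub>R f x" for r x
    by (metis scale scaleC_of_real scaleR_conv_of_real)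
  have bl: "bounded_linear f"
    by (rule bounded_linear_intro[of _ K]) (auto simp: add scaleR bound mult.commute)
  have "J x \<ge> - K\<^sup>2" for x
  proof -
    have "Re (f x) \<le> K * norm x" using bound[of x] complex_Re_le_cmod[of "f x"] by linarith
    moreover have "0 \<le> (norm x - K)\<^sup>2" by simp
    ultimately show ?thesis by (simp add: J_def power2_eq_square algebra_simps)
  qed
  then have bb: "bdd_below (range J)" by (auto intro: bdd_belowI[of _ "- K\<^sup>2"])
  then have dle: "d \<le> J x" for x unfolding d_def by (intro cInf_lower) auto
  have "\<exists>x. J x < d + 1 / Suc n" for n
    using cInf_less_iff[of "range J" "d + 1 / Suc n"] bb by (auto simp: d_def)
  then obtain X where X: "\<And>n. J (X n) < d + 1 / Suc n" by metis
  \<comment> \<open>The linear terms of \<open>J\<close> cancel at the midpoint, which leaves the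
    parallelogram identity. Since \<open>J\<close> is at least \<open>d\<close> at the midpoint, two
    near-minimisers must be close.\<close>
  have par: "(norm (x - y))\<^sup>2 = 2 * J x + 2 * J y - 4 * J ((1/2) *\<^sub>R (x + y))" for x y
  proof -
    have "(norm (x - y))\<^sup>2 = (norm x)\<^sup>2 - 2 * Re (cinner x y) + (norm y)\<^sup>2"
      using norm_add_sq[of x "-y"] by (simp add: cinner.minus_right)
    then show ?thesis
      using norm_add_sq[of x y]
      by (simp add: J_def scaleR add power_mult_distrib power_divide del: scaleR_add_right)
         (simp add: field_simps)
  qed
  have close: "(norm (X m - X n))\<^sup>2 < 4 / Suc N" if "m \<ge> N" "n \<ge> N" for m n N
  proof -
    have "1 / real (Suc m) \<le> 1 / Suc N" "1 / real (Suc n) \<le> 1 / Suc N"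
      using that by (auto simp: field_simps)
    then show ?thesis
      using X[of m] X[of n] dle[of "(1/2) *\<^sub>R (X m + X n)"] par[of "X m" "X n"] by simp
  qed
  have "Cauchy X"
  proof (rule metric_CauchyI)
    fix e :: real assume "e > 0"
    then obtain N where N: "inverse (real (Suc N)) < e\<^sup>2 / 4"
      using reals_Archimedean[of "e\<^sup>2 / 4"] by auto
    have "dist (X m) (X n) < e" if "m \<ge> N" "n \<ge> N" for m n
    proof -
      have "(norm (X m - X n))\<^sup>2 < e\<^sup>2"
        using close[OF that] N by (simp add: inverse_eq_divide)
      then show ?thesis using \<open>e > 0\<close> by (simp add: dist_norm power2_less_imp_less)
    qed
    then show "\<exists>M. \<forall>m\<ge>M. \<forall>n\<ge>M. dist (X m) (X n) < e" by blast
  qed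
  then obtain z where z: "X \<longlonglongrightarrow> z"
    using Cauchy_convergent convergent_def by blast
  have "(\<lambda>n. J (X n)) \<longlonglongrightarrow> J z"
    unfolding J_def by (intro tendsto_intros bounded_linear.tendsto[OF bl] z)
  moreover have "(\<lambda>n. d + 1 / real (Suc n)) \<longlonglongrightarrow> d"
    using tendsto_add[OF tendsto_const[of d] lim_inverse_n'[THEN LIMSEQ_Suc]] by simp
  ultimately have Jz: "J z \<le> d"
    using X by (intro LIMSEQ_le[of "\<lambda>n. J (X n)" "J z" "\<lambda>n. d + 1 / real (Suc n)"]) (auto intro: less_imp_le)
  have Re_eq: "Re (cinner z w) = Re (f w)" for w
  proof -
    define p where "p = Re (cinner z w) - Re (f w)"
    \<comment> \<open>The added 1 keeps \<open>W\<close> positive even for \<open>w = 0\<close>. The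
      step \<open>t\<close> would be the optimal one with \<open>W\<close> equal to the squared norm
      of \<open>w\<close>; this slightly shorter step still forces \<open>p = 0\<close>.\<close>
    define W where "W = (norm w)\<^sup>2 + 1"
    define t where "t = - p / W"
    have pos: "W > 0" by (simp add: W_def add_nonneg_pos)
    have "J (z + t *\<^sub>R w) = J z + 2 * t * p + t\<^sup>2 * (norm w)\<^sup>2"
      by (simp add: J_def norm_add_sq add scaleR cinner_scaleR_right p_def power_mult_distrib algebra_simps)
    then have "0 \<le> 2 * t * p + t\<^sup>2 * (norm w)\<^sup>2"
      using dle[of "z + t *\<^sub>R w"] Jz by linarith
    also have "\<dots> \<le> 2 * t * p + t\<^sup>2 * W" by (simp add: W_def algebra_simps)
    also have "\<dots> = - p\<^sup>2 / W"
      using pos by (simp add: t_def field_simps power2_eq_square)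
    finally show ?thesis using pos by (simp add: p_def divide_le_0_iff zero_le_divide_iff)
  qed
  have "cinner z x = f x" for x
    using Re_eq[of x] Re_eq[of "\<i> *\<^sub>C x"] by (simp add: complex_eq_iff scale cinner_scaleC_right)
  then show ?thesis by blast
qed

text \<open>\<open>adj\<close> is a definite description. The inner product separates vectors, which
  gives uniqueness, so exhibiting a candidate determines the adjoint without an appeal to Riesz
  representation.\<close>

lemma adj_eqI:
  assumes "\<And>x y. cinner (S y) x = cinner y (T x)"
  shows "adj T = S"
proof
  fix y show "adj T y = S y"
    unfolding adj_def by (rule the_equality) (auto simp: assms intro: cinner_eqI)
qed

text \<open>Existence of the described vector is the point where completeness enters, through
  \<open>Riesz_representation\<close>.\<close>

lemma cinner_adj_left: "cinner (adj T y) x = cinner y (T x)"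
  if T: "bdd_op T" for T :: "'a::chilbert_space \<Rightarrow> 'a"
proof -
  obtain K where K: "\<And>x. norm (T x) \<le> K * norm x" using T by (metis bdd_op_bound)
  have "cmod (cinner y (T x)) \<le> (norm y * K) * norm x" for x
    using order_trans[OF Cauchy_Schwarz_cinner mult_left_mono[OF K, of "norm y" x]]
    by (simp add: mult.assoc)
  then obtain z where z: "\<And>x. cinner z x = cinner y (T x)"
    using Riesz_representation[of "\<lambda>x. cinner y (T x)" "norm y * K"]
    by (auto simp: bdd_op_add[OF T] bdd_op_scaleC[OF T] cinner_add_right cinner_scaleC_right)
  then have "adj T y = z"
    unfolding adj_def by (intro the_equality) (auto intro: cinner_eqI)
  with z show ?thesis by simp
qed

lemma cinner_adj_right: "cinner x (adj T y) = cinner (T x) y"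
  if "bdd_op T" for T :: "'a::chilbert_space \<Rightarrow> 'a"
  using arg_cong[OF cinner_adj_left[OF that, of y x], of cnj] by (simp add: cinner_commute[symmetric])

lemma norm_adj_le:
  fixes T :: "'a::chilbert_space \<Rightarrow> 'a"
  assumes "bdd_op T" and K: "\<And>x. norm (T x) \<le> K * norm x"
  shows "norm (adj T y) \<le> K * norm y"
proof (cases "adj T y = 0")
  case True
  \<comment> \<open>\<open>K\<close> carries no sign assumption; nonnegativity of
    \<open>K * norm y\<close> is read off from the bound at \<open>y\<close>.\<close>
  then show ?thesis using K[of y] norm_ge_zero[of "T y"] by (simp del: norm_ge_zero)
next
  case False
  have "(norm (adj T y))\<^sup>2 = Re (cinner y (T (adj T y)))"
    by (simp add: norm_sq_cinner cinner_adj_left[OF assms(1)])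
  also have "\<dots> \<le> norm y * norm (T (adj T y))"
    using complex_Re_le_cmod Cauchy_Schwarz_cinner order_trans by blast
  also have "\<dots> \<le> norm y * (K * norm (adj T y))" by (intro mult_left_mono K) auto
  finally show ?thesis using False by (simp add: power2_eq_square mult_ac)
qed

lemma bdd_op_adj: "bdd_op (adj T)" if T: "bdd_op T" for T :: "'a::chilbert_space \<Rightarrow> 'a"
proof -
  obtain K where K: "\<And>x. norm (T x) \<le> K * norm x" using T by (metis bdd_op_bound)
  show ?thesis
  proof (rule bdd_opI)
    show "norm (adj T x) \<le> K * norm x" for x by (rule norm_adj_le[OF T K])
    show "adj T (x + y) = adj T x + adj T y" for x y
      by (rule cinner_eqI) (simp add: cinner_adj_left[OF T] cinner_add_left)
    show "adj T (c *\<^sub>C x) = c *\<^sub>C adj T x" for c x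
      by (rule cinner_eqI) (simp add: cinner_adj_left[OF T] cinner_scaleC_left)
  qed
qed

lemma adj_adj: "adj (adj T) = T" if "bdd_op T" for T :: "'a::chilbert_space \<Rightarrow> 'a"
  by (rule adj_eqI) (simp add: cinner_adj_right that)

lemma adj_zero: "adj (\<lambda>x. 0) = (\<lambda>x. 0)"
  by (rule adj_eqI) (simp add: cinner.zero_left)

lemma adj_op_add: "adj (op_add S T) = op_add (adj S) (adj T)"
  if "bdd_op S" "bdd_op T" for S T :: "'a::chilbert_space \<Rightarrow> 'a"
  by (rule adj_eqI) (simp add: op_add_def cinner_add_left cinner_add_right cinner_adj_left that)

lemma adj_op_scale: "adj (op_scale c T) = op_scale (cnj c) (adj T)"
  if "bdd_op T" for T :: "'a::chilbert_space \<Rightarrow> 'a"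
  by (rule adj_eqI) (simp add: op_scale_def cinner_scaleC_left cinner_scaleC_right cinner_adj_left that)

lemma adj_comp: "adj (S \<circ> T) = adj T \<circ> adj S"
  if "bdd_op S" "bdd_op T" for S T :: "'a::chilbert_space \<Rightarrow> 'a"
  by (rule adj_eqI) (simp add: cinner_adj_left that)

text \<open>The adjoint does not increase norms, so a norm approximation of an operator also
  approximates its adjoint. Writing the difference with \<open>op_add\<close> and
  \<open>op_scale\<close> makes the algebraic rules for \<open>adj\<close> applicable.\<close>

lemma adj_diff_le:
  fixes S T :: "'a::chilbert_space \<Rightarrow> 'a"
  assumes S: "bdd_op S" and T: "bdd_op T" and K: "\<And>x. norm (T x - S x) \<le> K * norm x"
  shows "norm (adj T x - adj S x) \<le> K * norm x"
proof -
  define D where "D = op_add T (op_scale (-1) S)"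
  have D: "D = (\<lambda>x. T x - S x)"
    by (simp add: D_def op_add_def op_scale_def scaleC_minus1)
  have "bdd_op D" unfolding D_def by (intro bdd_op_op_add bdd_op_op_scale S T)
  then have "norm (adj D x) \<le> K * norm x" by (rule norm_adj_le) (simp add: D K)
  moreover have "adj D x = adj T x - adj S x"
    unfolding D_def using S T
    by (simp add: adj_op_add adj_op_scale bdd_op_op_scale) (simp add: op_add_def op_scale_def scaleC_minus1)
  ultimately show ?thesis by simp
qed

text \<open>Pointwise bounds \<open>e * norm x\<close> replace \<open>onorm\<close>, since
  approximations arise in that form; halving \<open>e\<close> restores the strict
  inequality.\<close>

lemma norm_closedD:
  assumes "norm_closed B" "bdd_op T" and B: "B \<subseteq> Collect bdd_op"
    and appr: "\<And>e. e > 0 \<Longrightarrow> \<exists>S\<in>B. \<forall>x. norm (T x - S x) \<le> e * norm x"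
  shows "T \<in> B"
proof -
  have "\<exists>S\<in>B. onorm (\<lambda>x. T x - S x) < e" if e: "e > 0" for e
  proof -
    obtain S where "S \<in> B" "\<forall>x. norm (T x - S x) \<le> e / 2 * norm x"
      using appr[of "e / 2"] e by (metis half_gt_zero)
    then show ?thesis
      using onorm_bound[of "e / 2" "\<lambda>x. T x - S x"] e by force
  qed
  then show ?thesis using assms unfolding norm_closed_def by blast
qed

lemma norm_closedI:
  assumes B: "B \<subseteq> Collect bdd_op"
    and clo: "\<And>T. bdd_op T \<Longrightarrow> (\<And>e. e > 0 \<Longrightarrow> \<exists>S\<in>B. \<forall>x. norm (T x - S x) \<le> e * norm x) \<Longrightarrow> T \<in> B"
  shows "norm_closed B"
  unfolding norm_closed_def
proof (intro allI impI)
  fix T assume T: "bdd_op T \<and> (\<forall>e>0. \<exists>S\<in>B. onorm (\<lambda>x. T x - S x) < e)"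
  show "T \<in> B"
  proof (rule clo)
    fix e :: real assume "e > 0"
    then obtain S where S: "S \<in> B" "onorm (\<lambda>x. T x - S x) < e" using T by blast
    have "bounded_linear (\<lambda>x. T x - S x)"
      using S(1) B T by (intro bounded_linear_sub bdd_op_bounded_linear) auto
    then have "norm (T x - S x) \<le> onorm (\<lambda>x. T x - S x) * norm x" for x by (rule onorm)
    also have "\<dots> x \<le> e * norm x" for x using S(2) by (intro mult_right_mono) auto
    finally show "\<exists>S\<in>B. \<forall>x. norm (T x - S x) \<le> e * norm x" using S(1) by blast
  qed (use T in blast)
qed

section \<open>Operator algebras and their homomorphisms\<close>

lemma op_add_apply: "op_add S T x = S x + T x" and op_scale_apply: "op_scale c T x = c *\<^sub>C T x"
  by (simp_all add: op_add_def op_scale_def)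

lemma op_algebraD:
  assumes "op_algebra A"
  shows op_algebra_bdd: "T \<in> A \<Longrightarrow> bdd_op T"
    and op_algebra_zero: "(\<lambda>x. 0) \<in> A"
    and op_algebra_add: "S \<in> A \<Longrightarrow> T \<in> A \<Longrightarrow> op_add S T \<in> A"
    and op_algebra_comp: "S \<in> A \<Longrightarrow> T \<in> A \<Longrightarrow> S \<circ> T \<in> A"
    and op_algebra_scale: "T \<in> A \<Longrightarrow> op_scale c T \<in> A"
  using assms unfolding op_algebra_def by auto

lemma alg_homD:
  assumes "alg_hom A \<rho>"
  shows alg_hom_add: "S \<in> A \<Longrightarrow> T \<in> A \<Longrightarrow> \<rho> (op_add S T) = op_add (\<rho> S) (\<rho> T)"
    and alg_hom_comp: "S \<in> A \<Longrightarrow> T \<in> A \<Longrightarrow> \<rho> (S \<circ> T) = \<rho> S \<circ> \<rho> T"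
    and alg_hom_scale: "T \<in> A \<Longrightarrow> \<rho> (op_scale c T) = op_scale c (\<rho> T)"
  using assms unfolding alg_hom_def by auto

lemma star_repD:
  assumes "star_rep C \<theta>"
  shows star_rep_alg_hom: "alg_hom C \<theta>"
    and star_rep_bdd: "T \<in> C \<Longrightarrow> bdd_op (\<theta> T)"
    and star_rep_adj: "T \<in> C \<Longrightarrow> \<theta> (adj T) = adj (\<theta> T)"
  using assms unfolding star_rep_def by auto

lemma alg_hom_zero:
  assumes "op_algebra A" "alg_hom A \<rho>"
  shows "\<rho> (\<lambda>x. 0) = (\<lambda>x. 0)"
  using alg_hom_scale[OF assms(2) op_algebra_zero[OF assms(1)], of 0]
  by (simp add: op_scale_def)

text \<open>Entries of matrix products are finite sums of compositions, while
  \<open>op_algebra\<close> only speaks of binary sums; the zero operator covers the empty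
  sum.\<close>

lemma op_algebra_sum:
  assumes A: "op_algebra A" and I: "finite I" "\<And>i. i \<in> I \<Longrightarrow> f i \<in> A"
  shows "(\<lambda>x. \<Sum>i\<in>I. f i x) \<in> A"
  using I
proof (induction I)
  case (insert i I)
  then have "op_add (f i) (\<lambda>x. \<Sum>i\<in>I. f i x) \<in> A" by (intro op_algebra_add A) auto
  then show ?case using insert by (simp add: op_add_def)
qed (simp add: op_algebra_zero A)

lemma alg_hom_sum:
  assumes A: "op_algebra A" and \<rho>: "alg_hom A \<rho>" and I: "finite I" "\<And>i. i \<in> I \<Longrightarrow> f i \<in> A"
  shows "\<rho> (\<lambda>x. \<Sum>i\<in>I. f i x) = (\<lambda>x. \<Sum>i\<in>I. \<rho> (f i) x)"
  using I
proof (induction I)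
  case (insert i I)
  have "\<rho> (op_add (f i) (\<lambda>x. \<Sum>i\<in>I. f i x)) = op_add (\<rho> (f i)) (\<rho> (\<lambda>x. \<Sum>i\<in>I. f i x))"
    using insert by (intro alg_hom_add[OF \<rho>] op_algebra_sum[OF A]) auto
  then show ?case using insert by (simp add: op_add_def)
qed (simp add: alg_hom_zero[OF A \<rho>])

text \<open>Split \<open>S k (y k) - S' y'\<close> into \<open>S k (y k - y')\<close> and
  \<open>S k y' - S' y'\<close>. The constant \<open>K\<close>, common to all \<open>k\<close>, is
  what makes the first term vanish.\<close>

lemma strong_tendsto_comp:
  fixes S :: "'i \<Rightarrow> 'a::complex_inner \<Rightarrow> 'a"
  assumes S: "eventually (\<lambda>k. bdd_op (S k) \<and> (\<forall>x. norm (S k x) \<le> K * norm x)) F"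
    and lim: "\<And>x. ((\<lambda>k. S k x) \<longlongrightarrow> S' x) F" and y: "(y \<longlongrightarrow> y') F"
  shows "((\<lambda>k. S k (y k)) \<longlongrightarrow> S' y') F"
proof -
  have "((\<lambda>k. K * norm (y k - y')) \<longlongrightarrow> K * norm (y' - y')) F"
    by (intro tendsto_intros y)
  then have null: "((\<lambda>k. K * norm (y k - y')) \<longlongrightarrow> 0) F" by simp
  have "\<forall>\<^sub>F k in F. norm (S k (y k) - S k y') \<le> K * norm (y k - y')"
    using S by eventually_elim (metis bdd_op_diff)
  then have "((\<lambda>k. S k (y k) - S k y') \<longlongrightarrow> 0) F"
    by (rule Lim_null_comparison[OF _ null])
  from tendsto_add[OF this lim[of y']] show ?thesis by simp
qed

text \<open>Increments sum to a geometric tail. The limit comes with a rate that is uniform over the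
  unit ball, and this uniformity is what later places it in a norm-closed algebra.\<close>

lemma geometric_operator_limit:
  fixes S :: "nat \<Rightarrow> 'a::chilbert_space \<Rightarrow> 'a"
  assumes S: "\<And>k. bdd_op (S k)" and s: "0 \<le> s" "s < 1"
    and step: "\<And>k x. norm (S (Suc k) x - S k x) \<le> s ^ k * norm x"
  obtains L where "bdd_op L" "\<And>x. (\<lambda>k. S k x) \<longlonglongrightarrow> L x"
    "\<And>k x. norm (L x - S k x) \<le> s ^ k / (1 - s) * norm x"
proof -
  \<comment> \<open>The fraction is the finite geometric sum of the powers of \<open>s\<close> from
    exponent \<open>k\<close> up to \<open>k + p - 1\<close>; in this closed form the induction on
    \<open>p\<close> is a one-line identity.\<close>
  have part: "norm (S (k + p) x - S k x) \<le> (s ^ k - s ^ (k + p)) / (1 - s) * norm x" for k p x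
  proof (induction p)
    case (Suc p)
    have "norm (S (k + Suc p) x - S k x) \<le> norm (S (Suc (k + p)) x - S (k + p) x) + norm (S (k + p) x - S k x)"
      using norm_triangle_ineq[of "S (Suc (k + p)) x - S (k + p) x" "S (k + p) x - S k x"] by simp
    also have "\<dots> \<le> s ^ (k + p) * norm x + (s ^ k - s ^ (k + p)) / (1 - s) * norm x"
      by (intro add_mono step Suc)
    also have "\<dots> = (s ^ k - s ^ (k + Suc p)) / (1 - s) * norm x"
      using s by (simp add: field_simps)
    finally show ?case .
  qed simp
  have bnd: "norm (S (k + p) x - S k x) \<le> s ^ k / (1 - s) * norm x" for k p x
    by (rule order_trans[OF part]) (use s in \<open>auto intro!: mult_right_mono divide_right_mono\<close>)
  have null: "(\<lambda>k. s ^ k / (1 - s) * c) \<longlonglongrightarrow> 0" for c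
    using LIMSEQ_realpow_zero[OF s] by (intro tendsto_mult_left_zero tendsto_divide_zero)
  have "Cauchy (\<lambda>k. S k x)" for x
  proof (rule CauchyI')
    fix e :: real assume "e > 0"
    then have "\<forall>\<^sub>F k in sequentially. s ^ k / (1 - s) * norm x < e"
      using order_tendstoD(2)[OF null] by blast
    then obtain M where M: "\<And>m. m \<ge> M \<Longrightarrow> s ^ m / (1 - s) * norm x < e"
      by (auto simp: eventually_sequentially)
    have "norm (S m x - S n x) < e" if "m \<ge> M" "n > m" for m n
      using bnd[of m "n - m" x] M[OF that(1)] that(2) by (simp add: norm_minus_commute)
    then show "\<exists>M. \<forall>m\<ge>M. \<forall>n>m. dist (S m x) (S n x) < e"
      by (auto simp: dist_norm)
  qed
  then have "\<exists>l. (\<lambda>k. S k x) \<longlonglongrightarrow> l" for x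
    using Cauchy_convergent convergent_def by blast
  then obtain L where L: "\<And>x. (\<lambda>k. S k x) \<longlonglongrightarrow> L x" by metis
  have close: "norm (L x - S k x) \<le> s ^ k / (1 - s) * norm x" for k x
  proof (rule LIMSEQ_le_const2)
    show "(\<lambda>p. norm (S (p + k) x - S k x)) \<longlonglongrightarrow> norm (L x - S k x)"
      by (intro tendsto_intros LIMSEQ_ignore_initial_segment L)
    show "\<exists>N. \<forall>p\<ge>N. norm (S (p + k) x - S k x) \<le> s ^ k / (1 - s) * norm x"
      using bnd by (metis add.commute)
  qed
  obtain K where K: "\<And>x. norm (S 0 x) \<le> K * norm x" using bdd_op_bound[OF S] by metis
  have "bdd_op L"
  proof (rule bdd_opI)
    show "L (x + y) = L x + L y" for x y
      by (rule LIMSEQ_unique[OF L]) (simp add: bdd_op_add[OF S] tendsto_add L)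
    show "L (c *\<^sub>C x) = c *\<^sub>C L x" for c x
      by (rule LIMSEQ_unique[OF L])
         (simp add: bdd_op_scaleC[OF S] bounded_linear.tendsto[OF bounded_linear_scaleC] L)
    show "norm (L x) \<le> (1 / (1 - s) + K) * norm x" for x
      using norm_triangle_ineq[of "L x - S 0 x" "S 0 x"] close[of x 0] K[of x]
      by (simp add: algebra_simps)
  qed
  with that L close show thesis by blast
qed

section \<open>Matrices of operators\<close>

definition mat_app :: "nat \<Rightarrow> (nat \<Rightarrow> nat \<Rightarrow> 'a \<Rightarrow> 'a) \<Rightarrow> (nat \<Rightarrow> 'a) \<Rightarrow> nat \<Rightarrow> 'a::complex_inner" where
  "mat_app n M x i = (\<Sum>j<n. M i j (x j))"

text \<open>The norm of the n-fold Hilbert space direct sum, expressed by \<open>L2_set\<close> so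
  that its triangle and Cauchy-Schwarz inequalities can be inherited.\<close>

definition vec_norm :: "nat \<Rightarrow> (nat \<Rightarrow> 'a::complex_inner) \<Rightarrow> real" where
  "vec_norm n x = L2_set (\<lambda>i. norm (x i)) {..<n}"

text \<open>Stands in for the supremum \<open>mat_norm\<close>: a bound can be scaled, composed and
  transferred without arguing about suprema.\<close>

definition mat_bound :: "nat \<Rightarrow> real \<Rightarrow> (nat \<Rightarrow> nat \<Rightarrow> 'a \<Rightarrow> 'a::complex_inner) \<Rightarrow> bool" where
  "mat_bound n K M \<longleftrightarrow> (\<forall>x. vec_norm n (mat_app n M x) \<le> K * vec_norm n x)"

lemma vec_norm_nonneg [simp]: "0 \<le> vec_norm n x"
  by (simp add: vec_norm_def L2_set_nonneg)

lemma vec_norm_sq: "(vec_norm n x)\<^sup>2 = (\<Sum>i<n. (norm (x i))\<^sup>2)"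
  by (simp add: vec_norm_def L2_set_def sum_nonneg)

lemma vec_norm_sq_cinner: "(vec_norm n x)\<^sup>2 = Re (\<Sum>i<n. cinner (x i) (x i))"
  by (simp add: vec_norm_sq norm_sq_cinner)

lemma vec_norm_add: "vec_norm n (\<lambda>i. x i + y i) \<le> vec_norm n x + vec_norm n y"
  unfolding vec_norm_def
  by (rule order_trans[OF L2_set_mono L2_set_triangle_ineq]) (auto simp: norm_triangle_ineq)

lemma vec_norm_scaleR: "vec_norm n (\<lambda>i. r *\<^sub>R x i) = \<bar>r\<bar> * vec_norm n x"
  by (simp add: vec_norm_def L2_set_right_distrib)

lemma norm_le_vec_norm: "i < n \<Longrightarrow> norm (x i) \<le> vec_norm n x"
  unfolding vec_norm_def by (rule member_le_L2_set) auto

lemma vec_norm_single: "j < n \<Longrightarrow> vec_norm n (\<lambda>i. if i = j then x else 0) = norm x"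
  unfolding vec_norm_def L2_set_def by (simp add: if_distrib[of norm] if_distrib[of "\<lambda>t. t\<^sup>2"] cong: if_cong)

lemma vec_Cauchy_Schwarz: "cmod (\<Sum>i<n. cinner (x i) (y i)) \<le> vec_norm n x * vec_norm n y"
proof -
  have "cmod (\<Sum>i<n. cinner (x i) (y i)) \<le> (\<Sum>i<n. cmod (cinner (x i) (y i)))" by (rule norm_sum)
  also have "\<dots> \<le> (\<Sum>i<n. \<bar>norm (x i)\<bar> * \<bar>norm (y i)\<bar>)"
    by (intro sum_mono) (simp add: Cauchy_Schwarz_cinner)
  also have "\<dots> \<le> vec_norm n x * vec_norm n y"
    unfolding vec_norm_def by (rule L2_set_mult_ineq)
  finally show ?thesis .
qed

lemma mat_app_single:
  assumes "\<And>j. j < n \<Longrightarrow> bdd_op (M i j)" "j < n"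
  shows "mat_app n M (\<lambda>k. if k = j then x else 0) i = M i j x"
proof -
  have "mat_app n M (\<lambda>k. if k = j then x else 0) i = (\<Sum>k<n. if k = j then M i k x else 0)"
    unfolding mat_app_def by (intro sum.cong) (auto simp: assms bdd_op_zero)
  then show ?thesis using assms(2) by simp
qed

text \<open>Test the matrix on a vector supported in coordinate \<open>j\<close> and read off
  coordinate \<open>i\<close>.\<close>

lemma mat_bound_entry:
  assumes "mat_bound n K M" "\<And>j. j < n \<Longrightarrow> bdd_op (M i j)" "i < n" "j < n"
  shows "norm (M i j x) \<le> K * norm x"
proof -
  let ?e = "\<lambda>k. if k = j then x else 0"
  have "norm (M i j x) = norm (mat_app n M ?e i)"
    using assms by (simp add: mat_app_single)
  also have "\<dots> \<le> vec_norm n (mat_app n M ?e)" by (rule norm_le_vec_norm) fact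
  also have "\<dots> \<le> K * vec_norm n ?e" using assms(1) by (simp add: mat_bound_def)
  finally show ?thesis using assms(4) by (simp add: vec_norm_single)
qed

lemma mat_app_mult:
  assumes "\<And>i j. i < n \<Longrightarrow> j < n \<Longrightarrow> bdd_op (M i j)" "i < n"
  shows "(\<Sum>j<n. \<Sum>l<n. M i l (N l j (x j))) = mat_app n M (mat_app n N x) i"
proof -
  have "(\<Sum>j<n. \<Sum>l<n. M i l (N l j (x j))) = (\<Sum>l<n. \<Sum>j<n. M i l (N l j (x j)))"
    by (rule sum.swap)
  also have "\<dots> = mat_app n M (mat_app n N x) i"
    unfolding mat_app_def by (intro sum.cong refl) (simp add: bdd_op_sum assms)
  finally show ?thesis .
qed

lemma cinner_mat_app:
  assumes "\<And>i j u v. i < n \<Longrightarrow> j < n \<Longrightarrow> cinner (N i j u) v = cinner u (M j i v)"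
  shows "(\<Sum>i<n. cinner (mat_app n N x i) (y i)) = (\<Sum>i<n. cinner (x i) (mat_app n M y i))"
proof -
  have "(\<Sum>i<n. cinner (mat_app n N x i) (y i)) = (\<Sum>i<n. \<Sum>j<n. cinner (x j) (M j i (y i)))"
    unfolding mat_app_def by (simp add: cinner.sum_left assms)
  also have "\<dots> = (\<Sum>j<n. \<Sum>i<n. cinner (x j) (M j i (y i)))" by (rule sum.swap)
  finally show ?thesis by (simp add: mat_app_def cinner.sum_right)
qed

text \<open>The squared norm of \<open>N x\<close> is the pairing of \<open>x\<close> with
  \<open>M (N x)\<close>, so one factor of that norm cancels. Adjointness enters as an entrywise
  pairing, which suits matrices given with or without \<open>adj\<close>.\<close>

lemma mat_bound_adjoint:
  assumes adj: "\<And>i j u v. i < n \<Longrightarrow> j < n \<Longrightarrow> cinner (N i j u) v = cinner u (M j i v)"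
    and M: "mat_bound n K M" and K: "0 \<le> K"
  shows "mat_bound n K N"
  unfolding mat_bound_def
proof
  fix x
  let ?y = "mat_app n N x"
  have "(vec_norm n ?y)\<^sup>2 = Re (\<Sum>i<n. cinner (x i) (mat_app n M ?y i))"
    unfolding vec_norm_sq_cinner by (subst cinner_mat_app[OF adj]) auto
  also have "\<dots> \<le> vec_norm n x * vec_norm n (mat_app n M ?y)"
    using order_trans[OF complex_Re_le_cmod vec_Cauchy_Schwarz] by blast
  also have "\<dots> \<le> vec_norm n x * (K * vec_norm n ?y)"
    using M by (intro mult_left_mono) (auto simp: mat_bound_def)
  finally have "vec_norm n ?y * vec_norm n ?y \<le> (K * vec_norm n x) * vec_norm n ?y"
    by (simp add: power2_eq_square mult_ac)
  then show "vec_norm n ?y \<le> K * vec_norm n x"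
    using K by (cases "vec_norm n ?y = 0") (auto simp: less_le)
qed

lemma mat_boundD: "mat_bound n K M \<Longrightarrow> vec_norm n (mat_app n M x) \<le> K * vec_norm n x"
  by (simp add: mat_bound_def)

lemma vec_norm_cong: "(\<And>i. i < n \<Longrightarrow> x i = y i) \<Longrightarrow> vec_norm n x = vec_norm n y"
  unfolding vec_norm_def by (rule L2_set_cong) auto

section \<open>The iteration for 1 - (1 - a)^(1/2) on operator matrices\<close>

lemma mat_app_diff:
  assumes "\<And>i j. i < n \<Longrightarrow> j < n \<Longrightarrow> bdd_op (M i j)" "i < n"
  shows "mat_app n M (\<lambda>j. x j - y j) i = mat_app n M x i - mat_app n M y i"
  using assms by (simp add: mat_app_def bdd_op_diff sum_subtractf)

lemma bdd_op_diff_op: "bdd_op (\<lambda>x. S x - T x)" if "bdd_op S" "bdd_op T"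
  using bdd_op_op_add[OF that(1) bdd_op_op_scale[OF that(2), of "-1"]]
  by (simp add: op_add_def op_scale_def scaleC_minus1)

text \<open>The matrix iteration b := (a + b^2) / 2, whose fixed points satisfy (1 - b)^2 = 1 - a.
  Starting at 0 makes every iterate a polynomial in a without constant term, so no unit is required
  in the algebra.\<close>

primrec sqrt_iter ::
  "nat \<Rightarrow> (nat \<Rightarrow> nat \<Rightarrow> 'a \<Rightarrow> 'a) \<Rightarrow> nat \<Rightarrow> nat \<Rightarrow> nat \<Rightarrow> 'a \<Rightarrow> 'a::complex_inner" where
  "sqrt_iter n a 0 = (\<lambda>i j x. 0)"
| "sqrt_iter n a (Suc k) = (\<lambda>i j x. (1/2) *\<^sub>R
     (a i j x + (\<Sum>l<n. sqrt_iter n a k i l (sqrt_iter n a k l j x))))"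

text \<open>Recasts the recursion in the operations that \<open>op_algebra\<close> and
  \<open>alg_hom\<close> are stated for.\<close>

lemma scaleR_add_sum_eq_op:
  "(\<lambda>x. r *\<^sub>R (S x + (\<Sum>l<n. P l (Q l x)))) =
   op_scale (complex_of_real r) (op_add S (\<lambda>x. \<Sum>l<n. (P l \<circ> Q l) x))"
  by (simp add: op_scale_def op_add_def scaleC_of_real)

lemma sqrt_iter_in_algebra:
  assumes A: "op_algebra A" and a: "\<And>i j. i < n \<Longrightarrow> j < n \<Longrightarrow> a i j \<in> A" and "i < n" "j < n"
  shows "sqrt_iter n a k i j \<in> A"
  using \<open>i < n\<close> \<open>j < n\<close>
proof (induction k arbitrary: i j)
  case (Suc k)
  show ?case
    unfolding sqrt_iter.simps(2)
      scaleR_add_sum_eq_op[where S = "a i j" and P = "sqrt_iter n a k i" and Q = "\<lambda>l. sqrt_iter n a k l j"]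
    by (intro op_algebra_scale[OF A] op_algebra_add[OF A] op_algebra_sum[OF A] op_algebra_comp[OF A] a Suc) auto
qed (simp add: op_algebra_zero[OF A])

lemma sqrt_iter_symmetric:
  assumes a: "\<And>i j u v. i < n \<Longrightarrow> j < n \<Longrightarrow> cinner (a i j u) v = cinner u (a j i v)"
    and "i < n" "j < n"
  shows "cinner (sqrt_iter n a k i j u) v = cinner u (sqrt_iter n a k j i v)"
  using \<open>i < n\<close> \<open>j < n\<close>
proof (induction k arbitrary: i j u v)
  case (Suc k)
  then show ?case
    by (simp add: a cinner_scaleR_left cinner_scaleR_right cinner_add_left cinner_add_right
        cinner.sum_left cinner.sum_right)
qed (simp add: cinner.zero_left)

lemma mat_app_sqrt_iter_Suc:
  assumes "\<And>i j. i < n \<Longrightarrow> j < n \<Longrightarrow> bdd_op (sqrt_iter n a k i j)" "i < n"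
  shows "mat_app n (sqrt_iter n a (Suc k)) x i = (1/2) *\<^sub>R
    (mat_app n a x i + mat_app n (sqrt_iter n a k) (mat_app n (sqrt_iter n a k) x) i)"
proof -
  have "mat_app n (sqrt_iter n a (Suc k)) x i = (1/2) *\<^sub>R (mat_app n a x i +
     (\<Sum>j<n. \<Sum>l<n. sqrt_iter n a k i l (sqrt_iter n a k l j (x j))))"
    by (simp add: mat_app_def scaleR_sum_right[symmetric] sum.distrib del: scaleR_add_right)
  then show ?thesis by (simp only: mat_app_mult[where M = "sqrt_iter n a k" and N = "sqrt_iter n a k", OF assms])
qed

text \<open>The ball of radius \<open>s\<close> is mapped into itself: if a is bounded by the square
  of \<open>s\<close> and b by \<open>s\<close>, then (a + b^2) / 2 is bounded by the square of
  \<open>s\<close>, which is at most \<open>s\<close>.\<close>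

lemma mat_bound_sqrt_iter:
  assumes bdd: "\<And>k i j. i < n \<Longrightarrow> j < n \<Longrightarrow> bdd_op (sqrt_iter n a k i j)"
    and a: "mat_bound n (s\<^sup>2) a" and s: "0 \<le> s" "s < 1"
  shows "mat_bound n s (sqrt_iter n a k)"
proof (induction k)
  case 0
  have "mat_app n (sqrt_iter n a 0) x = (\<lambda>i. 0)" for x by (auto simp: mat_app_def)
  then show ?case using s by (simp add: mat_bound_def vec_norm_def L2_set_def sum_nonneg)
next
  case (Suc k)
  let ?B = "mat_app n (sqrt_iter n a k)"
  show ?case
    unfolding mat_bound_def
  proof
    fix x
    have "vec_norm n (mat_app n (sqrt_iter n a (Suc k)) x)
        = vec_norm n (\<lambda>i. (1/2) *\<^sub>R (mat_app n a x i + ?B (?B x) i))"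
      by (rule vec_norm_cong) (rule mat_app_sqrt_iter_Suc[OF bdd])
    also have "\<dots> = 1/2 * vec_norm n (\<lambda>i. mat_app n a x i + ?B (?B x) i)"
      by (simp add: vec_norm_scaleR del: scaleR_add_right)
    also have "\<dots> \<le> 1/2 * (s\<^sup>2 * vec_norm n x + s * (s * vec_norm n x))"
    proof (intro mult_left_mono order_trans[OF vec_norm_add] add_mono)
      show "vec_norm n (?B (?B x)) \<le> s * (s * vec_norm n x)"
        using mat_boundD[OF Suc, of "?B x"] mult_left_mono[OF mat_boundD[OF Suc, of x] s(1)]
        by linarith
    qed (use a mat_boundD in auto)
    also have "\<dots> = s * s * vec_norm n x" by (simp add: power2_eq_square)
    also have "\<dots> \<le> s * vec_norm n x"
      using s by (intro mult_right_mono) (auto simp: mult_left_le)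
    finally show "vec_norm n (mat_app n (sqrt_iter n a (Suc k)) x) \<le> s * vec_norm n x" .
  qed
qed

text \<open>With D the difference of consecutive iterates b and b', the difference of squares is b'
  b' - b b = b' D + D b, an identity that needs no commutativity. Each summand gains a factor
  \<open>s\<close> and the factor 1/2 compensates for there being two. The induction must cover all
  \<open>x\<close>, because D is also applied to the image of \<open>x\<close> under b.\<close>

lemma vec_norm_sqrt_iter_diff:
  assumes bdd: "\<And>k i j. i < n \<Longrightarrow> j < n \<Longrightarrow> bdd_op (sqrt_iter n a k i j)"
    and a: "mat_bound n (s\<^sup>2) a" and s: "0 \<le> s" "s < 1"
  shows "vec_norm n (\<lambda>i. mat_app n (sqrt_iter n a (Suc k)) x i - mat_app n (sqrt_iter n a k) x i)
    \<le> s ^ k * vec_norm n x"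
proof (induction k arbitrary: x)
  case 0
  have "vec_norm n (\<lambda>i. mat_app n (sqrt_iter n a (Suc 0)) x i - mat_app n (sqrt_iter n a 0) x i)
      = vec_norm n (\<lambda>i. (1/2) *\<^sub>R mat_app n a x i)"
    by (rule vec_norm_cong) (simp add: mat_app_def scaleR_sum_right)
  also have "\<dots> = 1/2 * vec_norm n (mat_app n a x)"
    by (simp add: vec_norm_scaleR)
  also have "\<dots> \<le> 1/2 * (s\<^sup>2 * vec_norm n x)"
    using mat_boundD[OF a, of x] by simp
  also have "\<dots> \<le> 1 * vec_norm n x"
    using s power_le_one[of s 2] unfolding mult.assoc[symmetric] by (intro mult_right_mono) auto
  finally show ?case by simp
next
  case (Suc k)
  let ?B = "\<lambda>k. mat_app n (sqrt_iter n a k)"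
  let ?D = "\<lambda>x i. ?B (Suc k) x i - ?B k x i"
  have "vec_norm n (\<lambda>i. ?B (Suc (Suc k)) x i - ?B (Suc k) x i)
      = vec_norm n (\<lambda>i. (1/2) *\<^sub>R (?B (Suc k) (?D x) i + ?D (?B k x) i))"
  proof (rule vec_norm_cong)
    fix i assume i: "i < n"
    have diff: "?B (Suc k) (?D x) i = ?B (Suc k) (?B (Suc k) x) i - ?B (Suc k) (?B k x) i"
      by (rule mat_app_diff[OF bdd i])
    have "?B (Suc (Suc k)) x i - ?B (Suc k) x i =
        (1/2) *\<^sub>R (mat_app n a x i + ?B (Suc k) (?B (Suc k) x) i) -
        (1/2) *\<^sub>R (mat_app n a x i + ?B k (?B k x) i)"
      by (simp only: mat_app_sqrt_iter_Suc[OF bdd i, of "Suc k" x] mat_app_sqrt_iter_Suc[OF bdd i, of k x])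
    also have "\<dots> = (1/2) *\<^sub>R (?B (Suc k) (?D x) i + ?D (?B k x) i)"
      unfolding diff by (simp add: algebra_simps del: sqrt_iter.simps)
    finally show "?B (Suc (Suc k)) x i - ?B (Suc k) x i = (1/2) *\<^sub>R (?B (Suc k) (?D x) i + ?D (?B k x) i)" .
  qed
  also have "\<dots> = 1/2 * vec_norm n (\<lambda>i. ?B (Suc k) (?D x) i + ?D (?B k x) i)"
    by (simp add: vec_norm_scaleR del: scaleR_add_right sqrt_iter.simps)
  also have "\<dots> \<le> 1/2 * (s * (s ^ k * vec_norm n x) + s ^ k * (s * vec_norm n x))"
  proof (intro mult_left_mono order_trans[OF vec_norm_add] add_mono)
    note B = mat_bound_sqrt_iter[OF bdd a s, THEN mat_boundD]
    show "vec_norm n (?B (Suc k) (?D x)) \<le> s * (s ^ k * vec_norm n x)"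
      by (rule order_trans[OF B mult_left_mono[OF Suc s(1)]])
    show "vec_norm n (?D (?B k x)) \<le> s ^ k * (s * vec_norm n x)"
      by (rule order_trans[OF Suc mult_left_mono[OF B]]) (use s in auto)
  qed auto
  finally show ?case by (simp add: mult_ac)
qed

lemma sqrt_iter_entry_diff:
  assumes bdd: "\<And>k i j. i < n \<Longrightarrow> j < n \<Longrightarrow> bdd_op (sqrt_iter n a k i j)"
    and a: "mat_bound n (s\<^sup>2) a" and s: "0 \<le> s" "s < 1" and ij: "i < n" "j < n"
  shows "norm (sqrt_iter n a (Suc k) i j x - sqrt_iter n a k i j x) \<le> s ^ k * norm x"
proof (rule mat_bound_entry[OF _ _ ij])
  show "mat_bound n (s ^ k) (\<lambda>i j x. sqrt_iter n a (Suc k) i j x - sqrt_iter n a k i j x)"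
    (is "mat_bound n _ ?D")
  proof -
    have "mat_app n ?D x = (\<lambda>i. mat_app n (sqrt_iter n a (Suc k)) x i - mat_app n (sqrt_iter n a k) x i)" for x
      by (rule ext) (simp only: mat_app_def sum_subtractf)
    then show ?thesis
      unfolding mat_bound_def using vec_norm_sqrt_iter_diff[OF bdd a s] by presburger
  qed
qed (intro bdd_op_diff_op bdd ij)

text \<open>The iterates converge in norm, so the limit entries lie in the norm-closed
  \<open>C\<close>, while symmetry and the fixed-point equation pass to the limit pointwise. The
  output is an equation in \<open>C\<close> and not a limit, so it can be pushed through a
  homomorphism whose continuity is still open.\<close>

lemma matrix_sqrt_equation:
  fixes a :: "nat \<Rightarrow> nat \<Rightarrow> 'a::chilbert_space \<Rightarrow> 'a"
  assumes C: "op_algebra C" "norm_closed C" and aC: "\<And>i j. i < n \<Longrightarrow> j < n \<Longrightarrow> a i j \<in> C"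
    and a: "mat_bound n (s\<^sup>2) a" and s: "0 \<le> s" "s < 1"
    and sym: "\<And>i j u v. i < n \<Longrightarrow> j < n \<Longrightarrow> cinner (a i j u) v = cinner u (a j i v)"
  obtains b where "\<And>i j. i < n \<Longrightarrow> j < n \<Longrightarrow> b i j \<in> C"
    "\<And>i j u v. i < n \<Longrightarrow> j < n \<Longrightarrow> cinner (b i j u) v = cinner u (b j i v)"
    "\<And>i j x. i < n \<Longrightarrow> j < n \<Longrightarrow> b i j x = (1/2) *\<^sub>R (a i j x + (\<Sum>l<n. b i l (b l j x)))"
proof -
  have iC: "sqrt_iter n a k i j \<in> C" if "i < n" "j < n" for k i j
    by (rule sqrt_iter_in_algebra[OF C(1) aC that])
  have bdd: "bdd_op (sqrt_iter n a k i j)" if "i < n" "j < n" for k i j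
    using op_algebra_bdd[OF C(1) iC[OF that]] .
  define P where "P i j L \<longleftrightarrow> bdd_op L \<and> (\<forall>x. (\<lambda>k. sqrt_iter n a k i j x) \<longlonglongrightarrow> L x) \<and>
    (\<forall>k x. norm (L x - sqrt_iter n a k i j x) \<le> s ^ k / (1 - s) * norm x)" for i j L
  have "\<exists>L. P i j L" if ij: "i < n" "j < n" for i j
    using geometric_operator_limit[of "\<lambda>k. sqrt_iter n a k i j", OF bdd[OF ij] s
        sqrt_iter_entry_diff[OF bdd a s ij]] unfolding P_def by metis
  then obtain b where P: "\<And>i j. i < n \<Longrightarrow> j < n \<Longrightarrow> P i j (b i j)" by metis
  have lim: "(\<lambda>k. sqrt_iter n a k i j x) \<longlonglongrightarrow> b i j x" if "i < n" "j < n" for i j x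
    using P[OF that] by (simp add: P_def)
  show thesis
  proof (rule that[of b])
    fix i j assume ij: "i < n" "j < n"
    show "b i j \<in> C"
    proof (rule norm_closedD[OF C(2)])
      show "bdd_op (b i j)" using P[OF ij] by (simp add: P_def)
      fix e :: real assume "e > 0"
      have "(\<lambda>k. s ^ k / (1 - s)) \<longlonglongrightarrow> 0"
        using LIMSEQ_realpow_zero[OF s] by (intro tendsto_divide_zero)
      then have "\<forall>\<^sub>F k in sequentially. s ^ k / (1 - s) < e"
        using order_tendstoD(2) \<open>e > 0\<close> by blast
      then obtain k where "s ^ k / (1 - s) < e" by (auto simp: eventually_sequentially)
      then have "s ^ k / (1 - s) * norm x \<le> e * norm x" for x by (intro mult_right_mono) auto
      then have "norm (b i j x - sqrt_iter n a k i j x) \<le> e * norm x" for x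
        using P[OF ij] order_trans unfolding P_def by blast
      then show "\<exists>S\<in>C. \<forall>x. norm (b i j x - S x) \<le> e * norm x" using iC[OF ij] by blast
    qed (use op_algebra_bdd[OF C(1)] in auto)
    show "cinner (b i j u) v = cinner u (b j i v)" for u v
    proof (rule LIMSEQ_unique)
      show "(\<lambda>k. cinner (sqrt_iter n a k i j u) v) \<longlonglongrightarrow> cinner (b i j u) v"
        by (intro cinner.tendsto lim ij tendsto_const)
      have "cinner (sqrt_iter n a k i j u) v = cinner u (sqrt_iter n a k j i v)" for k
        by (rule sqrt_iter_symmetric[OF sym ij])
      then show "(\<lambda>k. cinner (sqrt_iter n a k i j u) v) \<longlonglongrightarrow> cinner u (b j i v)"
        by (simp only:) (intro cinner.tendsto lim ij tendsto_const)
    qed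
    show "b i j x = (1/2) *\<^sub>R (a i j x + (\<Sum>l<n. b i l (b l j x)))" for x
    proof -
      have "(\<lambda>k. sqrt_iter n a k i l (sqrt_iter n a k l j x)) \<longlonglongrightarrow> b i l (b l j x)"
        if l: "l < n" for l
      proof (rule strong_tendsto_comp[OF _ lim[OF ij(1) l] lim[OF l ij(2)]])
        \<comment> \<open>The bound \<open>s\<close> is independent of the index \<open>k\<close>,
          so products of the convergent sequences converge.\<close>
        have "norm (sqrt_iter n a k i l x) \<le> s * norm x" for k x
          by (rule mat_bound_entry[OF mat_bound_sqrt_iter[OF bdd a s] bdd]) (use ij l in auto)
        then show "\<forall>\<^sub>F k in sequentially. bdd_op (sqrt_iter n a k i l) \<and>
            (\<forall>x. norm (sqrt_iter n a k i l x) \<le> s * norm x)"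
          using bdd[OF ij(1) l] by simp
      qed
      then have "(\<lambda>k. sqrt_iter n a (Suc k) i j x) \<longlonglongrightarrow> (1/2) *\<^sub>R (a i j x + (\<Sum>l<n. b i l (b l j x)))"
        unfolding sqrt_iter.simps(2) by (intro tendsto_intros) auto
      with LIMSEQ_Suc[OF lim[OF ij]] show ?thesis by (rule LIMSEQ_unique)
    qed
  qed
qed

section \<open>Complete contractivity of *-representations\<close>

text \<open>Write \<open>a = M\<^sup>* M\<close> and let \<open>b = b\<^sup>*\<close> solve \<open>a = 2 b - b\<^sup>2\<close>, so that \<open>1 - a = (1 - b)\<^sup>2\<close>.
  Applying \<open>\<theta>\<close> entrywise gives \<open>\<parallel>x\<parallel>\<^sup>2 - \<parallel>\<theta>(M) x\<parallel>\<^sup>2 = \<parallel>x - \<theta>(b) x\<parallel>\<^sup>2\<close>.\<close>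

lemma star_rep_strict_contraction:
  fixes C :: "('a::chilbert_space \<Rightarrow> 'a) set" and \<theta> :: "('a \<Rightarrow> 'a) \<Rightarrow> 'b::chilbert_space \<Rightarrow> 'b"
  assumes C: "cstar_subalg C" and \<theta>: "star_rep C \<theta>"
    and MC: "\<And>i j. i < n \<Longrightarrow> j < n \<Longrightarrow> M i j \<in> C"
    and M: "mat_bound n s M" and s: "0 \<le> s" "s < 1"
  shows "mat_bound n 1 (\<lambda>i j. \<theta> (M i j))"
proof -
  have A: "op_algebra C" "norm_closed C" and Cadj: "\<And>T. T \<in> C \<Longrightarrow> adj T \<in> C"
    using C by (auto simp: cstar_subalg_def)
  note hom = star_rep_alg_hom[OF \<theta>]
  have Mb: "bdd_op (M i j)" if "i < n" "j < n" for i j using op_algebra_bdd[OF A(1) MC[OF that]] .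
  define N where "N i j = adj (M j i)" for i j
  define a where "a i j = (\<lambda>x. \<Sum>k<n. (N i k \<circ> M k j) x)" for i j
  have N: "cinner (N i j u) v = cinner u (M j i v)" if "i < n" "j < n" for i j u v
    using that by (simp add: N_def cinner_adj_left Mb)
  have M': "cinner (M i j u) v = cinner u (N j i v)" if "i < n" "j < n" for i j u v
    using that by (simp add: N_def cinner_adj_right Mb)
  have NC: "N i j \<in> C" if "i < n" "j < n" for i j using that by (simp add: N_def Cadj MC)
  have Nb: "bdd_op (N i j)" if "i < n" "j < n" for i j using op_algebra_bdd[OF A(1) NC[OF that]] .
  have aC: "a i j \<in> C" if "i < n" "j < n" for i j
    unfolding a_def using that by (intro op_algebra_sum[OF A(1)] op_algebra_comp[OF A(1)] NC MC) auto
  have asym: "cinner (a i j u) v = cinner u (a j i v)" if "i < n" "j < n" for i j u v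
    using that by (simp add: a_def cinner.sum_left cinner.sum_right N M')
  have abd: "mat_bound n (s\<^sup>2) a"
    unfolding mat_bound_def
  proof
    fix x
    have "vec_norm n (mat_app n a x) = vec_norm n (mat_app n N (mat_app n M x))"
      by (rule vec_norm_cong) (simp add: mat_app_mult[where M = N, OF Nb, symmetric], simp add: mat_app_def a_def)
    also have "\<dots> \<le> s * vec_norm n (mat_app n M x)"
      using mat_bound_adjoint[OF N M s(1)] by (rule mat_boundD)
    also have "\<dots> \<le> s * (s * vec_norm n x)" by (intro mult_left_mono mat_boundD M s)
    finally show "vec_norm n (mat_app n a x) \<le> s\<^sup>2 * vec_norm n x"
      by (simp add: power2_eq_square mult.assoc)
  qed
  obtain b where bC: "\<And>i j. i < n \<Longrightarrow> j < n \<Longrightarrow> b i j \<in> C"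
    and bsym: "\<And>i j u v. i < n \<Longrightarrow> j < n \<Longrightarrow> cinner (b i j u) v = cinner u (b j i v)"
    and beq: "\<And>i j x. i < n \<Longrightarrow> j < n \<Longrightarrow> b i j x = (1/2) *\<^sub>R (a i j x + (\<Sum>l<n. b i l (b l j x)))"
    using matrix_sqrt_equation[where a = a and n = n, OF A aC abd s asym] by blast
  \<comment> \<open>Nothing is claimed about the images of the approximants of \<open>b\<close>:
    only its equation and its symmetry are transported through \<open>\<theta>\<close>.\<close>
  define B where "B i j = \<theta> (b i j)" for i j
  have Bb: "bdd_op (B i j)" if "i < n" "j < n" for i j
    using star_rep_bdd[OF \<theta> bC[OF that]] by (simp add: B_def)
  have \<theta>M: "bdd_op (\<theta> (M i j))" if "i < n" "j < n" for i j
    using star_rep_bdd[OF \<theta> MC[OF that]] .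
  have Bsym: "cinner (B i j u) v = cinner u (B j i v)" if ij: "i < n" "j < n" for i j u v
  proof -
    have "b i j = adj (b j i)" by (rule adj_eqI[symmetric]) (rule bsym[OF ij])
    then have "B i j = adj (B j i)"
      unfolding B_def using star_rep_adj[OF \<theta> bC] ij by simp
    then show ?thesis using Bb ij by (simp add: cinner_adj_left)
  qed
  have \<theta>a: "\<theta> (a i j) = (\<lambda>x. \<Sum>k<n. adj (\<theta> (M k i)) (\<theta> (M k j) x))" if ij: "i < n" "j < n" for i j
  proof -
    have "\<theta> (a i j) = (\<lambda>x. \<Sum>k<n. \<theta> (N i k \<circ> M k j) x)"
      unfolding a_def using ij by (intro alg_hom_sum[OF A(1) hom] op_algebra_comp[OF A(1)] NC MC) auto
    also have "\<dots> = (\<lambda>x. \<Sum>k<n. adj (\<theta> (M k i)) (\<theta> (M k j) x))"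
      using ij by (intro ext sum.cong refl)
        (simp add: alg_hom_comp[OF hom NC MC], simp add: N_def star_rep_adj[OF \<theta> MC])
    finally show ?thesis .
  qed
  have Beq: "B i j x = (1/2) *\<^sub>R (\<theta> (a i j) x + (\<Sum>l<n. B i l (B l j x)))"
    if ij: "i < n" "j < n" for i j x
  proof -
    have "b i j = (\<lambda>x. (1/2) *\<^sub>R (a i j x + (\<Sum>l<n. b i l (b l j x))))"
      using beq[OF ij] by (rule ext)
    also have "\<dots> = op_scale (complex_of_real (1/2)) (op_add (a i j) (\<lambda>x. \<Sum>l<n. (b i l \<circ> b l j) x))"
      by (rule scaleR_add_sum_eq_op)
    finally have b: "b i j = \<dots>" .
    have in_C: "(\<lambda>x. \<Sum>l<n. (b i l \<circ> b l j) x) \<in> C"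
      using ij by (intro op_algebra_sum[OF A(1)] op_algebra_comp[OF A(1)] bC) auto
    have "\<theta> (\<lambda>x. \<Sum>l<n. (b i l \<circ> b l j) x) = (\<lambda>x. \<Sum>l<n. \<theta> (b i l \<circ> b l j) x)"
      using ij by (intro alg_hom_sum[OF A(1) hom] op_algebra_comp[OF A(1)] bC) auto
    also have "\<dots> = (\<lambda>x. \<Sum>l<n. (B i l \<circ> B l j) x)"
      using ij by (intro ext sum.cong refl) (simp add: alg_hom_comp[OF hom bC bC] B_def)
    finally have sq: "\<theta> (\<lambda>x. \<Sum>l<n. (b i l \<circ> b l j) x) = \<dots>" .
    have "B i j = op_scale (complex_of_real (1/2)) (op_add (\<theta> (a i j)) (\<lambda>x. \<Sum>l<n. (B i l \<circ> B l j) x))"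
      unfolding B_def[of i j] b
      by (simp only: alg_hom_scale[OF hom op_algebra_add[OF A(1) aC[OF ij] in_C]]
          alg_hom_add[OF hom aC[OF ij] in_C] sq)
    then show ?thesis by (simp only: scaleR_add_sum_eq_op[symmetric])
  qed
  show ?thesis
    unfolding mat_bound_def
  proof
    fix x
    let ?B = "mat_app n B" and ?M = "mat_app n (\<lambda>i j. \<theta> (M i j))" and ?a = "mat_app n (\<lambda>i j. \<theta> (a i j))"
    \<comment> \<open>The image under \<open>\<theta>\<close> of a = 2 b - b^2, read as an identity
      of matrices acting on the vector \<open>x\<close>.\<close>
    have ax: "?a x i = 2 *\<^sub>R ?B x i - ?B (?B x) i" if i: "i < n" for i
    proof -
      have "2 *\<^sub>R ?B x i = (\<Sum>j<n. \<theta> (a i j) (x j) + (\<Sum>l<n. B i l (B l j (x j))))"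
        unfolding mat_app_def scaleR_sum_right
        by (intro sum.cong refl, subst Beq) (use i in auto)
      then show ?thesis using mat_app_mult[where M = B and N = B and x = x, OF Bb i] by (simp add: sum.distrib mat_app_def)
    qed
    have "(vec_norm n (?M x))\<^sup>2 = Re (\<Sum>i<n. cinner (?M x i) (?M x i))"
      by (rule vec_norm_sq_cinner)
    also have "(\<Sum>i<n. cinner (?M x i) (?M x i)) =
        (\<Sum>i<n. cinner (x i) (mat_app n (\<lambda>i j. adj (\<theta> (M j i))) (?M x) i))"
      by (rule cinner_mat_app) (simp add: cinner_adj_right \<theta>M)
    also have "\<dots> = (\<Sum>i<n. cinner (x i) (?a x i))"
    proof (intro sum.cong refl arg_cong[where f = "cinner _"])
      fix i assume "i \<in> {..<n}"
      then have i: "i < n" by simp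
      have adjb: "bdd_op (adj (\<theta> (M j i)))" if "i < n" "j < n" for i j
        using that by (simp add: bdd_op_adj \<theta>M)
      show "mat_app n (\<lambda>i j. adj (\<theta> (M j i))) (?M x) i = ?a x i"
        using i by (subst mat_app_mult[where M = "\<lambda>i j. adj (\<theta> (M j i))", OF adjb i, symmetric]) (auto simp: mat_app_def \<theta>a)
    qed
    also have "\<dots> = (\<Sum>i<n. 2 *\<^sub>R cinner (x i) (?B x i) - cinner (x i) (?B (?B x) i))"
      by (intro sum.cong refl) (simp add: ax cinner_diff_right cinner_scaleR_right)
    also have "\<dots> = 2 *\<^sub>R (\<Sum>i<n. cinner (x i) (?B x i)) - (\<Sum>i<n. cinner (?B x i) (?B x i))"
      by (simp add: sum_subtractf scaleR_sum_right cinner_mat_app[where M = B and N = B and x = x and y = "?B x", OF Bsym])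
    finally have eq: "(vec_norm n (?M x))\<^sup>2 = 2 * Re (\<Sum>i<n. cinner (x i) (?B x i)) - (vec_norm n (?B x))\<^sup>2"
      by (simp add: vec_norm_sq_cinner)
    \<comment> \<open>Instead of the full square of x - B x, Cauchy-Schwarz and the square of the
      real number ||x|| - ||B x|| suffice.\<close>
    have "2 * Re (\<Sum>i<n. cinner (x i) (?B x i)) \<le> 2 * (vec_norm n x * vec_norm n (?B x))"
      using order_trans[OF complex_Re_le_cmod vec_Cauchy_Schwarz] by (intro mult_left_mono) auto
    then have "(vec_norm n (?M x))\<^sup>2 \<le> (vec_norm n x)\<^sup>2"
      using eq zero_le_power2[of "vec_norm n x - vec_norm n (?B x)"] by (simp add: power2_diff)
    then show "vec_norm n (?M x) \<le> 1 * vec_norm n x"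
      using power2_le_imp_le[of "vec_norm n (?M x)" "vec_norm n x"] by simp
  qed
qed

text \<open>Dividing by any \<open>t > K\<close> gives a matrix of bound \<open>K / t < 1\<close>,
  to which the strict case applies; then \<open>t\<close> descends to \<open>K\<close>. A vector of
  norm 0 is settled separately, since the descent divides by its norm.\<close>

lemma star_rep_mat_bound:
  fixes C :: "('a::chilbert_space \<Rightarrow> 'a) set" and \<theta> :: "('a \<Rightarrow> 'a) \<Rightarrow> 'b::chilbert_space \<Rightarrow> 'b"
  assumes C: "cstar_subalg C" and \<theta>: "star_rep C \<theta>"
    and MC: "\<And>i j. i < n \<Longrightarrow> j < n \<Longrightarrow> M i j \<in> C"
    and M: "mat_bound n K M" and K: "0 \<le> K"
  shows "mat_bound n K (\<lambda>i j. \<theta> (M i j))"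
  unfolding mat_bound_def
proof
  fix x
  let ?M = "mat_app n (\<lambda>i j. \<theta> (M i j))"
  have A: "op_algebra C" using C by (simp add: cstar_subalg_def)
  have *: "vec_norm n (?M x) \<le> t * vec_norm n x" if t: "K < t" for t
  proof -
    have t0: "t > 0" using t K by simp
    define M' where "M' i j = op_scale (complex_of_real (1/t)) (M i j)" for i j
    have app: "mat_app n (\<lambda>i j. op_scale (complex_of_real (1/t)) (N i j)) y = (\<lambda>i. (1/t) *\<^sub>R mat_app n N y i)"
      for N :: "nat \<Rightarrow> nat \<Rightarrow> 'c \<Rightarrow> 'c::complex_inner" and y
      by (rule ext) (simp only: mat_app_def op_scale_def scaleC_of_real scaleR_sum_right)
    have "mat_bound n (K / t) M'"
      unfolding mat_bound_def M'_def app vec_norm_scaleR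
      using mat_boundD[OF M] t0 by (auto simp: divide_simps mult.commute)
    moreover have "M' i j \<in> C" if "i < n" "j < n" for i j
      unfolding M'_def using that by (intro op_algebra_scale[OF A] MC)
    ultimately have "mat_bound n 1 (\<lambda>i j. \<theta> (M' i j))"
      using star_rep_strict_contraction[OF C \<theta>, of n M' "K / t"] t t0 K by simp
    then have "vec_norm n (mat_app n (\<lambda>i j. \<theta> (M' i j)) x) \<le> vec_norm n x"
      using mat_boundD by fastforce
    also have "vec_norm n (mat_app n (\<lambda>i j. \<theta> (M' i j)) x) = vec_norm n (\<lambda>i. (1/t) *\<^sub>R ?M x i)"
      unfolding app[symmetric]
      by (rule vec_norm_cong)
         (simp add: mat_app_def M'_def alg_hom_scale[OF star_rep_alg_hom[OF \<theta>] MC] del: of_real_divide)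
    finally show ?thesis using t0 by (simp add: vec_norm_scaleR divide_simps mult.commute)
  qed
  show "vec_norm n (?M x) \<le> K * vec_norm n x"
  proof (cases "vec_norm n x = 0")
    case True
    then show ?thesis using *[of "K + 1"] by simp
  next
    case False
    then have pos: "vec_norm n x > 0" by (simp add: less_le)
    have "vec_norm n (?M x) / vec_norm n x \<le> K"
      by (rule dense_ge) (use * pos in \<open>simp add: divide_simps\<close>)
    then show ?thesis using pos by (simp add: divide_simps)
  qed
qed

text \<open>The sum of all entry bounds is crude, but it is only used to make the supremum in
  \<open>mat_norm\<close> one over a bounded set.\<close>

lemma mat_bound_exists:
  assumes M: "\<And>i j. i < n \<Longrightarrow> j < n \<Longrightarrow> bdd_op (M i j)"
  shows "\<exists>K. mat_bound n K M"
proof -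
  have "\<forall>i j. \<exists>k. i < n \<longrightarrow> j < n \<longrightarrow> 0 < k \<and> (\<forall>x. norm (M i j x) \<le> k * norm x)"
    using bdd_op_bound[OF M] by blast
  then obtain k where k: "\<And>i j. i < n \<Longrightarrow> j < n \<Longrightarrow> 0 < k i j"
    "\<And>i j x. i < n \<Longrightarrow> j < n \<Longrightarrow> norm (M i j x) \<le> k i j * norm x" by metis
  have "vec_norm n (mat_app n M x) \<le> (\<Sum>i<n. \<Sum>j<n. k i j) * vec_norm n x" for x
  proof -
    have "vec_norm n (mat_app n M x) \<le> (\<Sum>i<n. norm (mat_app n M x i))"
      unfolding vec_norm_def by (rule L2_set_le_sum) auto
    also have "\<dots> \<le> (\<Sum>i<n. \<Sum>j<n. k i j * vec_norm n x)"
      unfolding mat_app_def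
    proof (intro sum_mono order_trans[OF norm_sum])
      fix i j assume "i \<in> {..<n}" "j \<in> {..<n}"
      then show "norm (M i j (x j)) \<le> k i j * vec_norm n x"
        using order_trans[OF k(2) mult_left_mono[OF norm_le_vec_norm less_imp_le[OF k(1)]]] by simp
    qed
    finally show ?thesis by (simp add: sum_distrib_right)
  qed
  then show ?thesis unfolding mat_bound_def by blast
qed

section \<open>Passing between \<open>mat_norm\<close> and \<open>mat_bound\<close>\<close>

lemma mat_norm_altdef:
  "mat_norm n M = Sup {vec_norm n (mat_app n M x) | x. (vec_norm n x)\<^sup>2 \<le> 1}"
  unfolding mat_norm_def vec_norm_sq unfolding vec_norm_def L2_set_def mat_app_def ..

text \<open>A real \<open>Sup\<close> is informative only for nonempty sets bounded above; the zero
  vector and the crude bound provide both. Homogeneity extends the estimate from the unit ball, and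
  for vectors of norm 0 the crude bound is used directly.\<close>

lemma mat_norm_nonneg_bound:
  assumes M: "\<And>i j. i < n \<Longrightarrow> j < n \<Longrightarrow> bdd_op (M i j)"
  shows mat_norm_nonneg: "0 \<le> mat_norm n M" and mat_bound_mat_norm: "mat_bound n (mat_norm n M) M"
proof -
  obtain K where K: "mat_bound n K M" using mat_bound_exists[of n M] M by blast
  have "vec_norm n (mat_app n M x) \<le> \<bar>K\<bar>" if "(vec_norm n x)\<^sup>2 \<le> 1" for x
  proof -
    have "vec_norm n x \<le> 1" using that by (simp add: abs_square_le_1)
    then have "\<bar>K\<bar> * vec_norm n x \<le> \<bar>K\<bar> * 1" by (intro mult_left_mono) auto
    moreover have "K * vec_norm n x \<le> \<bar>K\<bar> * vec_norm n x" by (intro mult_right_mono) auto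
    ultimately show ?thesis using mat_boundD[OF K, of x] by linarith
  qed
  then have "bdd_above {vec_norm n (mat_app n M x) | x. (vec_norm n x)\<^sup>2 \<le> 1}"
    by (intro bdd_aboveI[of _ "\<bar>K\<bar>"]) auto
  then have upper: "vec_norm n (mat_app n M x) \<le> mat_norm n M" if "(vec_norm n x)\<^sup>2 \<le> 1" for x
    unfolding mat_norm_altdef using that by (intro cSup_upper) auto
  show "0 \<le> mat_norm n M"
    by (rule order_trans[OF vec_norm_nonneg upper[of "\<lambda>_. 0"]]) (simp add: vec_norm_sq)
  show "mat_bound n (mat_norm n M) M"
    unfolding mat_bound_def
  proof
    fix x
    show "vec_norm n (mat_app n M x) \<le> mat_norm n M * vec_norm n x"
    proof (cases "vec_norm n x = 0")
      case True
      then show ?thesis using mat_boundD[OF K, of x] by simp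
    next
      case False
      let ?r = "1 / vec_norm n x"
      have pos: "vec_norm n x > 0" using False by (simp add: less_le)
      have "vec_norm n (mat_app n M (\<lambda>i. ?r *\<^sub>R x i)) \<le> mat_norm n M"
        using False by (intro upper) (simp add: vec_norm_scaleR)
      also have "vec_norm n (mat_app n M (\<lambda>i. ?r *\<^sub>R x i)) = vec_norm n (\<lambda>i. ?r *\<^sub>R mat_app n M x i)"
        by (rule vec_norm_cong) (simp add: mat_app_def bdd_op_scaleR[OF M] scaleR_sum_right)
      finally show ?thesis using pos by (simp add: vec_norm_scaleR divide_simps)
    qed
  qed
qed

lemma mat_norm_le:
  assumes M: "mat_bound n K M" and K: "0 \<le> K"
  shows "mat_norm n M \<le> K"
  unfolding mat_norm_altdef
proof (rule cSup_least)
  show "{vec_norm n (mat_app n M x) |x. (vec_norm n x)\<^sup>2 \<le> 1} \<noteq> {}"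
    by (auto intro!: exI[of _ "\<lambda>_. 0"] simp: vec_norm_sq)
  fix r assume "r \<in> {vec_norm n (mat_app n M x) |x. (vec_norm n x)\<^sup>2 \<le> 1}"
  then obtain x where x: "r = vec_norm n (mat_app n M x)" "(vec_norm n x)\<^sup>2 \<le> 1" by blast
  then have "vec_norm n x \<le> 1" by (simp add: abs_square_le_1)
  then show "r \<le> K" using mat_boundD[OF M, of x] mult_left_mono[of "vec_norm n x" 1 K] K x by simp
qed

lemma star_rep_mat_norm_le:
  fixes C :: "('a::chilbert_space \<Rightarrow> 'a) set" and \<theta> :: "('a \<Rightarrow> 'a) \<Rightarrow> 'b::chilbert_space \<Rightarrow> 'b"
  assumes C: "cstar_subalg C" and \<theta>: "star_rep C \<theta>"
    and MC: "\<And>i j. i < n \<Longrightarrow> j < n \<Longrightarrow> M i j \<in> C"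
  shows "mat_norm n (\<lambda>i j. \<theta> (M i j)) \<le> mat_norm n M"
proof -
  have Mb: "bdd_op (M i j)" if "i < n" "j < n" for i j
    using MC[OF that] C by (auto simp: cstar_subalg_def dest: op_algebra_bdd)
  note nonneg = mat_norm_nonneg[where M = M, OF Mb]
  have "mat_bound n (mat_norm n M) (\<lambda>i j. \<theta> (M i j))"
    by (rule star_rep_mat_bound[OF C \<theta> MC mat_bound_mat_norm[OF Mb] nonneg])
  then show ?thesis by (rule mat_norm_le) (rule nonneg)
qed

lemma star_rep_norm_le:
  fixes C :: "('a::chilbert_space \<Rightarrow> 'a) set" and \<theta> :: "('a \<Rightarrow> 'a) \<Rightarrow> 'b::chilbert_space \<Rightarrow> 'b"
  assumes C: "cstar_subalg C" and \<theta>: "star_rep C \<theta>" and T: "T \<in> C"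
    and bound: "\<And>x. norm (T x) \<le> K * norm x" and K: "0 \<le> K"
  shows "norm (\<theta> T x) \<le> K * norm x"
proof -
  have vn: "vec_norm (Suc 0) y = norm (y 0)" for y :: "nat \<Rightarrow> 'c::complex_inner"
    by (simp add: vec_norm_def L2_set_def)
  have "mat_bound (Suc 0) K (\<lambda>i j. T)" by (simp add: mat_bound_def vn mat_app_def bound)
  then have "mat_bound (Suc 0) K (\<lambda>i j. \<theta> T)"
    by (intro star_rep_mat_bound[where M = "\<lambda>i j. T", OF C \<theta>] T K)
  from mat_boundD[OF this, of "\<lambda>_. x"] show ?thesis by (simp add: vn mat_app_def)
qed

text \<open>The constant does not depend on the representation, so one norm approximation in
  \<open>C\<close> serves the limit and all members of a net simultaneously.\<close>

lemma star_rep_diff_le: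
  fixes C :: "('a::chilbert_space \<Rightarrow> 'a) set" and \<theta> :: "('a \<Rightarrow> 'a) \<Rightarrow> 'b::chilbert_space \<Rightarrow> 'b"
  assumes C: "cstar_subalg C" and \<theta>: "star_rep C \<theta>" and S: "S \<in> C" and T: "T \<in> C"
    and bound: "\<And>x. norm (T x - S x) \<le> K * norm x" and K: "0 \<le> K"
  shows "norm (\<theta> T x - \<theta> S x) \<le> K * norm x"
proof -
  define D where "D = op_add T (op_scale (-1) S)"
  have A: "op_algebra C" using C by (simp add: cstar_subalg_def)
  note hom = star_rep_alg_hom[OF \<theta>] and sS = op_algebra_scale[OF A S, of "-1"]
  have "norm (\<theta> D x) \<le> K * norm x"
  proof (rule star_rep_norm_le[OF C \<theta> _ _ K])
    show "D \<in> C" unfolding D_def by (rule op_algebra_add[OF A T sS])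
    show "norm (D y) \<le> K * norm y" for y
      using bound[of y] by (simp add: D_def op_add_def op_scale_def scaleC_minus1)
  qed
  moreover have "\<theta> D = op_add (\<theta> T) (op_scale (-1) (\<theta> S))"
    unfolding D_def by (simp add: alg_hom_add[OF hom T sS] alg_hom_scale[OF hom S])
  ultimately show ?thesis by (simp add: op_add_def op_scale_def scaleC_minus1)
qed

section \<open>Generated C*-algebras\<close>

lemma cstar_subalgI:
  assumes "B \<subseteq> Collect bdd_op" "(\<lambda>x. 0) \<in> B"
    and "\<And>S T. S \<in> B \<Longrightarrow> T \<in> B \<Longrightarrow> op_add S T \<in> B" "\<And>S T. S \<in> B \<Longrightarrow> T \<in> B \<Longrightarrow> S \<circ> T \<in> B"
    and "\<And>c T. T \<in> B \<Longrightarrow> op_scale c T \<in> B" "\<And>T. T \<in> B \<Longrightarrow> adj T \<in> B"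
    and "\<And>T. bdd_op T \<Longrightarrow> (\<And>e. e > 0 \<Longrightarrow> \<exists>S\<in>B. \<forall>x. norm (T x - S x) \<le> e * norm x) \<Longrightarrow> T \<in> B"
  shows "cstar_subalg B"
proof -
  have "norm_closed B" by (rule norm_closedI[OF assms(1,7)])
  then show ?thesis using assms(1-6) by (simp add: cstar_subalg_def op_algebra_def)
qed

lemma cstar_subalgD:
  assumes "cstar_subalg C"
  shows cstar_subalg_op_algebra: "op_algebra C" and cstar_subalg_adj: "T \<in> C \<Longrightarrow> adj T \<in> C"
    and cstar_subalg_bdd: "T \<in> C \<Longrightarrow> bdd_op T"
    and cstar_subalg_closed:
      "bdd_op T \<Longrightarrow> (\<And>e. e > 0 \<Longrightarrow> \<exists>S\<in>C. \<forall>x. norm (T x - S x) \<le> e * norm x) \<Longrightarrow> T \<in> C"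
proof -
  show A: "op_algebra C" using assms by (simp add: cstar_subalg_def)
  show "T \<in> C \<Longrightarrow> adj T \<in> C" using assms by (simp add: cstar_subalg_def)
  show "T \<in> C \<Longrightarrow> bdd_op T" by (rule op_algebra_bdd[OF A])
  have "norm_closed C" "C \<subseteq> Collect bdd_op"
    using assms by (auto simp: cstar_subalg_def op_algebra_def)
  then show "T \<in> C" if "bdd_op T" "\<And>e. e > 0 \<Longrightarrow> \<exists>S\<in>C. \<forall>x. norm (T x - S x) \<le> e * norm x"
    using norm_closedD that by blast
qed

lemma cstar_gen_superset: "S \<subseteq> cstar_gen S"
  by (auto simp: cstar_gen_def)

lemma cstar_gen_least: "cstar_subalg B \<Longrightarrow> S \<subseteq> B \<Longrightarrow> cstar_gen S \<subseteq> B"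
  by (auto simp: cstar_gen_def)

text \<open>Makes the family intersected in \<open>cstar_gen\<close> nonempty for sets of bounded
  operators; an empty intersection would consist of all functions.\<close>

lemma cstar_subalg_bdd_ops: "cstar_subalg (Collect bdd_op :: ('a::chilbert_space \<Rightarrow> 'a) set)"
  by (rule cstar_subalgI)
     (auto simp: bdd_op_const_zero bdd_op_op_add bdd_op_comp bdd_op_op_scale bdd_op_adj)

lemma cstar_subalg_cstar_gen:
  fixes S :: "('a::chilbert_space \<Rightarrow> 'a) set"
  assumes S: "S \<subseteq> Collect bdd_op"
  shows "cstar_subalg (cstar_gen S)"
proof (rule cstar_subalgI)
  show "cstar_gen S \<subseteq> Collect bdd_op"
    by (rule cstar_gen_least[OF cstar_subalg_bdd_ops S])
next
  fix T :: "'a \<Rightarrow> 'a"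
  assume T: "bdd_op T" and appr: "\<And>e. e > 0 \<Longrightarrow> \<exists>R\<in>cstar_gen S. \<forall>x. norm (T x - R x) \<le> e * norm x"
  show "T \<in> cstar_gen S"
    unfolding cstar_gen_def
  proof (rule InterI)
    fix B assume "B \<in> {B. cstar_subalg B \<and> S \<subseteq> B}"
    then have B: "cstar_subalg B" "cstar_gen S \<subseteq> B" using cstar_gen_least by auto
    show "T \<in> B" by (rule cstar_subalg_closed[OF B(1) T]) (use appr B(2) in blast)
  qed
qed (simp_all add: cstar_gen_def op_algebra_zero op_algebra_add op_algebra_comp op_algebra_scale
    cstar_subalg_adj cstar_subalg_op_algebra)

text \<open>Norm-closedness is the part that rests on contractivity. Pulling \<open>D\<close> back
  avoids the question whether the image of a *-representation is norm-closed.\<close>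

lemma cstar_subalg_preimage:
  fixes C :: "('a::chilbert_space \<Rightarrow> 'a) set" and \<theta> :: "('a \<Rightarrow> 'a) \<Rightarrow> 'b::chilbert_space \<Rightarrow> 'b"
  assumes C: "cstar_subalg C" and D: "cstar_subalg D" and \<theta>: "star_rep C \<theta>"
  shows "cstar_subalg {T \<in> C. \<theta> T \<in> D}"
proof (rule cstar_subalgI)
  note CA = cstar_subalg_op_algebra[OF C] and DA = cstar_subalg_op_algebra[OF D]
    and hom = star_rep_alg_hom[OF \<theta>]
  show "{T \<in> C. \<theta> T \<in> D} \<subseteq> Collect bdd_op" using cstar_subalg_bdd[OF C] by auto
  show "(\<lambda>x. 0) \<in> {T \<in> C. \<theta> T \<in> D}"
    by (simp add: alg_hom_zero[OF CA hom] op_algebra_zero CA DA)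
  fix S T c assume S: "S \<in> {T \<in> C. \<theta> T \<in> D}" and T: "T \<in> {T \<in> C. \<theta> T \<in> D}"
  show "op_add S T \<in> {T \<in> C. \<theta> T \<in> D}"
    using S T by (simp add: alg_hom_add[OF hom] op_algebra_add CA DA)
  show "S \<circ> T \<in> {T \<in> C. \<theta> T \<in> D}"
    using S T by (simp add: alg_hom_comp[OF hom] op_algebra_comp CA DA)
  show "op_scale c T \<in> {T \<in> C. \<theta> T \<in> D}"
    using T by (simp add: alg_hom_scale[OF hom] op_algebra_scale CA DA)
  show "adj T \<in> {T \<in> C. \<theta> T \<in> D}"
    using T by (simp add: star_rep_adj[OF \<theta>] cstar_subalg_adj C D)
next
  fix T assume T: "bdd_op T"
    and appr: "\<And>e. e > 0 \<Longrightarrow> \<exists>S\<in>{T \<in> C. \<theta> T \<in> D}. \<forall>x. norm (T x - S x) \<le> e * norm x"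
  have TC: "T \<in> C" by (rule cstar_subalg_closed[OF C T]) (use appr in blast)
  moreover have "\<theta> T \<in> D"
  proof (rule cstar_subalg_closed[OF D star_rep_bdd[OF \<theta> TC]])
    fix e :: real assume e: "e > 0"
    then obtain S where "S \<in> C" "\<theta> S \<in> D" "\<And>x. norm (T x - S x) \<le> e * norm x"
      using appr by blast
    then show "\<exists>R\<in>D. \<forall>x. norm (\<theta> T x - R x) \<le> e * norm x"
      using star_rep_diff_le[OF C \<theta> _ TC] e by (meson less_imp_le)
  qed
  ultimately show "T \<in> {T \<in> C. \<theta> T \<in> D}" by simp
qed

text \<open>The preimage of \<open>D\<close> is a C*-algebra containing the generators, so
  minimality of \<open>cstar_gen\<close> applies. This confines the range of a lifted
  representation.\<close>

lemma star_rep_image_cstar_gen: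
  fixes S :: "('a::chilbert_space \<Rightarrow> 'a) set" and \<theta> :: "('a \<Rightarrow> 'a) \<Rightarrow> 'b::chilbert_space \<Rightarrow> 'b"
  assumes S: "S \<subseteq> Collect bdd_op" and \<theta>: "star_rep (cstar_gen S) \<theta>"
    and D: "cstar_subalg D" "\<theta> ` S \<subseteq> D"
  shows "\<theta> ` cstar_gen S \<subseteq> D"
proof -
  have "cstar_gen S \<subseteq> {T \<in> cstar_gen S. \<theta> T \<in> D}"
    using D(2) cstar_gen_superset[of S]
    by (intro cstar_gen_least cstar_subalg_preimage cstar_subalg_cstar_gen S D \<theta>) auto
  then show ?thesis by blast
qed

section \<open>Strong convergence of nets of *-representations\<close>

lemma strong_limit_of_uniform_approx:
  fixes C :: "('a::chilbert_space \<Rightarrow> 'a) set" and \<pi> :: "'i \<Rightarrow> ('a \<Rightarrow> 'a) \<Rightarrow> 'b::chilbert_space \<Rightarrow> 'b"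
  assumes C: "cstar_subalg C" and \<theta>: "star_rep C \<theta>" and \<pi>: "eventually (\<lambda>i. star_rep C (\<pi> i)) F"
    and T: "T \<in> C"
    and appr: "\<And>e. e > 0 \<Longrightarrow>
      \<exists>S\<in>C. (\<forall>x. norm (T x - S x) \<le> e * norm x) \<and> ((\<lambda>i. \<pi> i S h) \<longlongrightarrow> \<theta> S h) F"
  shows "((\<lambda>i. \<pi> i T h) \<longlongrightarrow> \<theta> T h) F"
proof (rule tendstoI)
  fix e :: real assume e: "e > 0"
  \<comment> \<open>One third of \<open>e\<close> is allotted to each of the three gaps between the
    values at \<open>T\<close>, at \<open>S\<close> and in the limit; the added 1 covers
    \<open>h = 0\<close>.\<close>
  define d where "d = e / (3 * (norm h + 1))"
  have n: "norm h + 1 > 0" by (simp add: add_nonneg_pos)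
  then have d: "d > 0" using e by (simp add: d_def)
  have dh: "d * norm h \<le> e / 3" using n e by (simp add: d_def field_simps)
  obtain S where S: "S \<in> C" "\<And>x. norm (T x - S x) \<le> d * norm x" "((\<lambda>i. \<pi> i S h) \<longlongrightarrow> \<theta> S h) F"
    using appr[OF d] by blast
  have \<theta>h: "norm (\<theta> T h - \<theta> S h) \<le> d * norm h"
    using star_rep_diff_le[OF C \<theta> S(1) T S(2)] d by simp
  have "\<forall>\<^sub>F i in F. dist (\<pi> i S h) (\<theta> S h) < e / 3" using tendstoD[OF S(3), of "e / 3"] e by simp
  then show "\<forall>\<^sub>F i in F. dist (\<pi> i T h) (\<theta> T h) < e"
    using \<pi>
  proof eventually_elim
    case (elim i)
    have "norm (\<pi> i T h - \<pi> i S h) \<le> d * norm h"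
      using star_rep_diff_le[OF C elim(2) S(1) T S(2)] d by simp
    then show ?case
      using \<theta>h dh elim(1) dist_triangle[of "\<pi> i T h" "\<theta> T h" "\<pi> i S h"]
        dist_triangle[of "\<pi> i S h" "\<theta> T h" "\<theta> S h"]
      by (simp add: dist_norm norm_minus_commute)
  qed
qed

lemma cstar_subalg_strong_limit:
  fixes C :: "('a::chilbert_space \<Rightarrow> 'a) set" and \<pi> :: "'i \<Rightarrow> ('a \<Rightarrow> 'a) \<Rightarrow> 'b::chilbert_space \<Rightarrow> 'b"
  assumes C: "cstar_subalg C" and \<theta>: "star_rep C \<theta>" and \<pi>: "eventually (\<lambda>i. star_rep C (\<pi> i)) F"
  shows "cstar_subalg {T \<in> C. \<forall>h. ((\<lambda>i. \<pi> i T h) \<longlongrightarrow> \<theta> T h) F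
    \<and> ((\<lambda>i. \<pi> i (adj T) h) \<longlongrightarrow> \<theta> (adj T) h) F}"
proof -
  note CA = cstar_subalg_op_algebra[OF C] and hom = star_rep_alg_hom[OF \<theta>]
  note bdd = cstar_subalg_bdd[OF C] and adjC = cstar_subalg_adj[OF C]
  define L where "L = {T \<in> C. \<forall>h. ((\<lambda>i. \<pi> i T h) \<longlongrightarrow> \<theta> T h) F}"
  have zero: "(\<lambda>x. 0) \<in> L"
  proof -
    have "\<forall>\<^sub>F i in F. \<pi> i (\<lambda>x. 0) h = 0" for h
      using \<pi> by eventually_elim (simp add: alg_hom_zero[OF CA star_rep_alg_hom])
    then show ?thesis
      unfolding L_def by (auto simp: op_algebra_zero[OF CA] alg_hom_zero[OF CA hom] intro: tendsto_eventually)
  qed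
  have add: "op_add S T \<in> L" if "S \<in> L" "T \<in> L" for S T
  proof -
    have ST: "S \<in> C" "T \<in> C" using that by (auto simp: L_def)
    have "((\<lambda>i. \<pi> i (op_add S T) h) \<longlongrightarrow> \<theta> (op_add S T) h) F" for h
    proof (rule Lim_transform_eventually)
      show "((\<lambda>i. \<pi> i S h + \<pi> i T h) \<longlongrightarrow> \<theta> (op_add S T) h) F"
        unfolding alg_hom_add[OF hom ST] op_add_apply using that by (auto simp: L_def intro!: tendsto_add)
      show "\<forall>\<^sub>F i in F. \<pi> i S h + \<pi> i T h = \<pi> i (op_add S T) h"
        using \<pi> by eventually_elim (simp only: alg_hom_add[OF star_rep_alg_hom ST] op_add_apply)
    qed
    then show ?thesis using ST by (simp add: L_def op_algebra_add[OF CA])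
  qed
  have comp: "S \<circ> T \<in> L" if "S \<in> L" "T \<in> L" for S T
  proof -
    have ST: "S \<in> C" "T \<in> C" using that by (auto simp: L_def)
    \<comment> \<open>By contractivity, a bound for \<open>S\<close> bounds \<open>\<pi> i S\<close>
      for all \<open>i\<close> at which \<open>\<pi> i\<close> is a *-representation. This is the
      uniformity that \<open>strong_tendsto_comp\<close> asks for.\<close>
    obtain K where K: "K > 0" "\<And>x. norm (S x) \<le> K * norm x" using bdd_op_bound[OF bdd[OF ST(1)]] by blast
    have "((\<lambda>i. \<pi> i (S \<circ> T) h) \<longlongrightarrow> \<theta> (S \<circ> T) h) F" for h
    proof (rule Lim_transform_eventually)
      have "\<forall>\<^sub>F i in F. bdd_op (\<pi> i S) \<and> (\<forall>x. norm (\<pi> i S x) \<le> K * norm x)"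
        using \<pi> by eventually_elim
          (use star_rep_bdd ST(1) star_rep_norm_le[OF C _ ST(1) K(2) less_imp_le[OF K(1)]] in blast)
      then show "((\<lambda>i. \<pi> i S (\<pi> i T h)) \<longlongrightarrow> \<theta> (S \<circ> T) h) F"
        unfolding alg_hom_comp[OF hom ST] o_apply
        by (rule strong_tendsto_comp) (use that in \<open>auto simp: L_def\<close>)
      show "\<forall>\<^sub>F i in F. \<pi> i S (\<pi> i T h) = \<pi> i (S \<circ> T) h"
        using \<pi> by eventually_elim (simp only: alg_hom_comp[OF star_rep_alg_hom ST] o_apply)
    qed
    then show ?thesis using ST by (simp add: L_def op_algebra_comp[OF CA])
  qed
  have scale: "op_scale c T \<in> L" if "T \<in> L" for c T
  proof -
    have T: "T \<in> C" using that by (auto simp: L_def)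
    have "((\<lambda>i. \<pi> i (op_scale c T) h) \<longlongrightarrow> \<theta> (op_scale c T) h) F" for h
    proof (rule Lim_transform_eventually)
      show "((\<lambda>i. c *\<^sub>C \<pi> i T h) \<longlongrightarrow> \<theta> (op_scale c T) h) F"
        unfolding alg_hom_scale[OF hom T] op_scale_apply
        using that by (intro bounded_linear.tendsto[OF bounded_linear_scaleC]) (simp add: L_def)
      show "\<forall>\<^sub>F i in F. c *\<^sub>C \<pi> i T h = \<pi> i (op_scale c T) h"
        using \<pi> by eventually_elim (simp only: alg_hom_scale[OF star_rep_alg_hom T] op_scale_apply)
    qed
    then show ?thesis using T by (simp add: L_def op_algebra_scale[OF CA])
  qed
  have closed: "T \<in> L" if "T \<in> C" "\<And>e. e > 0 \<Longrightarrow> \<exists>S\<in>L. \<forall>x. norm (T x - S x) \<le> e * norm x" for T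
  proof -
    have "((\<lambda>i. \<pi> i T h) \<longlongrightarrow> \<theta> T h) F" for h
    proof (rule strong_limit_of_uniform_approx[OF C \<theta> \<pi> that(1)])
      fix e :: real assume "e > 0"
      from that(2)[OF this] show
        "\<exists>S\<in>C. (\<forall>x. norm (T x - S x) \<le> e * norm x) \<and> ((\<lambda>i. \<pi> i S h) \<longlongrightarrow> \<theta> S h) F"
        unfolding L_def by blast
    qed
    then show ?thesis using that(1) by (simp add: L_def)
  qed
  \<comment> \<open>\<open>L\<close> is closed under the algebra operations and norm limits but need
    not be self-adjoint; the elements whose adjoint also lies in \<open>L\<close> form its
    self-adjoint part.\<close>
  have "cstar_subalg {T \<in> L. adj T \<in> L}"
  proof (rule cstar_subalgI)
    show "{T \<in> L. adj T \<in> L} \<subseteq> Collect bdd_op" using bdd by (auto simp: L_def)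
    have b: "bdd_op T" if "T \<in> L" for T using that bdd by (auto simp: L_def)
    show "(\<lambda>x. 0) \<in> {T \<in> L. adj T \<in> L}" using zero by (simp add: adj_zero)
    fix S T c assume S: "S \<in> {T \<in> L. adj T \<in> L}" and T: "T \<in> {T \<in> L. adj T \<in> L}"
    show "op_add S T \<in> {T \<in> L. adj T \<in> L}" using S T by (simp add: add adj_op_add b)
    show "S \<circ> T \<in> {T \<in> L. adj T \<in> L}" using S T by (simp add: comp adj_comp b)
    show "op_scale c T \<in> {T \<in> L. adj T \<in> L}" using T by (simp add: scale adj_op_scale b)
    show "adj T \<in> {T \<in> L. adj T \<in> L}" using T by (simp add: adj_adj b)
  next
    fix T assume T: "bdd_op T"
      and appr: "\<And>e. e > 0 \<Longrightarrow> \<exists>S\<in>{T \<in> L. adj T \<in> L}. \<forall>x. norm (T x - S x) \<le> e * norm x"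
    have TC: "T \<in> C" by (rule cstar_subalg_closed[OF C T]) (use appr L_def in blast)
    have "T \<in> L" by (rule closed[OF TC]) (use appr in blast)
    moreover have "adj T \<in> L"
    proof (rule closed[OF adjC[OF TC]])
      fix e :: real assume "e > 0"
      then obtain S where S: "S \<in> L" "adj S \<in> L" "\<And>x. norm (T x - S x) \<le> e * norm x"
        using appr by blast
      then show "\<exists>S\<in>L. \<forall>x. norm (adj T x - S x) \<le> e * norm x"
        using adj_diff_le[OF bdd T S(3)] by (auto simp: L_def)
    qed
    ultimately show "T \<in> {T \<in> L. adj T \<in> L}" by simp
  qed
  also have "{T \<in> L. adj T \<in> L} = {T \<in> C. \<forall>h. ((\<lambda>i. \<pi> i T h) \<longlongrightarrow> \<theta> T h) F
    \<and> ((\<lambda>i. \<pi> i (adj T) h) \<longlongrightarrow> \<theta> (adj T) h) F}"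
    using adjC by (auto simp: L_def)
  finally show ?thesis .
qed

section \<open>Finite-dimensional ranges\<close>

lemma cspan_zero: "0 \<in> cspan F"
  unfolding cspan_def by (auto intro!: exI[of _ "\<lambda>_. 0"])

lemma cspan_add: "x \<in> cspan F \<Longrightarrow> y \<in> cspan F \<Longrightarrow> x + y \<in> cspan F"
  unfolding cspan_def by (auto simp: sum.distrib[symmetric] scaleC_add_left[symmetric])

lemma cspan_scale: "x \<in> cspan F \<Longrightarrow> c *\<^sub>C x \<in> cspan F"
  unfolding cspan_def by (auto simp: scaleC_sum_right scaleC_scaleC)

lemma cspan_diff: "x \<in> cspan F \<Longrightarrow> y \<in> cspan F \<Longrightarrow> x - y \<in> cspan F"
  using cspan_add[of x F "(-1) *\<^sub>C y"] cspan_scale[of y F "-1"] by (simp add: scaleC_minus1)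

lemma cspan_insert:
  assumes "finite F" "f \<notin> F"
  shows "x \<in> cspan (insert f F) \<longleftrightarrow> (\<exists>v\<in>cspan F. \<exists>c. x = v + c *\<^sub>C f)"
proof
  assume "x \<in> cspan (insert f F)"
  then show "\<exists>v\<in>cspan F. \<exists>c. x = v + c *\<^sub>C f"
    using assms unfolding cspan_def by simp (metis add.commute)
next
  assume "\<exists>v\<in>cspan F. \<exists>c. x = v + c *\<^sub>C f"
  then obtain d c where x: "x = (\<Sum>y\<in>F. d y *\<^sub>C y) + c *\<^sub>C f" by (auto simp: cspan_def)
  have "(\<Sum>y\<in>F. d y *\<^sub>C y) = (\<Sum>y\<in>F. (d(f := c)) y *\<^sub>C y)"
    using assms(2) by (intro sum.cong) auto
  then have "x = (\<Sum>y\<in>insert f F. (d(f := c)) y *\<^sub>C y)"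
    using assms by (simp add: x add.commute)
  then show "x \<in> cspan (insert f F)" unfolding cspan_def by blast
qed

text \<open>A Gram-Schmidt step for each vector of \<open>F\<close>: the new vector \<open>f\<close>
  is replaced by its component \<open>g\<close> orthogonal to the old span, and the projection of
  \<open>x\<close> onto \<open>g\<close> is added to the previous one.\<close>

lemma cspan_orthogonal_projection:
  assumes "finite F"
  shows "\<exists>p\<in>cspan F. \<forall>v\<in>cspan F. cinner v (x - p) = 0"
  using assms
proof (induction F arbitrary: x)
  case empty
  then show ?case by (simp add: cspan_def cinner.zero_left)
next
  case (insert f F)
  obtain p where p: "p \<in> cspan F" "\<And>v. v \<in> cspan F \<Longrightarrow> cinner v (x - p) = 0"
    using insert.IH by blast
  obtain q where q: "q \<in> cspan F" "\<And>v. v \<in> cspan F \<Longrightarrow> cinner v (f - q) = 0"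
    using insert.IH by blast
  \<comment> \<open>If \<open>f = q\<close>, then \<open>\<alpha> = 0 / 0 = 0\<close>, which is the value that is needed.\<close>
  define g where "g = f - q"
  define \<alpha> where "\<alpha> = cinner g x / cinner g g"
  have gp: "cinner g v = 0" if "v \<in> cspan F" for v
    using q(2)[OF that] cinner_commute[of g v] by (simp add: g_def)
  show ?case
  proof (intro bexI ballI)
    show "p + \<alpha> *\<^sub>C g \<in> cspan (insert f F)"
      unfolding cspan_insert[OF insert.hyps]
    proof (intro bexI exI)
      show "p + \<alpha> *\<^sub>C g = (p - \<alpha> *\<^sub>C q) + \<alpha> *\<^sub>C f"
        using scaleC_add_right[of \<alpha> g q] by (simp add: g_def algebra_simps)
      show "p - \<alpha> *\<^sub>C q \<in> cspan F" by (intro cspan_diff cspan_scale p q)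
    qed
    fix w assume "w \<in> cspan (insert f F)"
    then obtain v c where v: "v \<in> cspan F" and w: "w = v + c *\<^sub>C f"
      unfolding cspan_insert[OF insert.hyps] by blast
    \<comment> \<open>Decomposing \<open>w\<close> into the old span and a multiple of
      \<open>g\<close> reduces the claim to two orthogonality relations.\<close>
    have w': "w = (v + c *\<^sub>C q) + c *\<^sub>C g"
      using scaleC_add_right[of c g q] by (simp add: w g_def algebra_simps)
    have v': "v + c *\<^sub>C q \<in> cspan F" by (intro cspan_add cspan_scale v q)
    have "cinner (v + c *\<^sub>C q) (x - (p + \<alpha> *\<^sub>C g)) = 0"
      using p(2)[OF v'] q(2)[OF v']
      by (simp add: cinner_diff_right cinner_add_right cinner_scaleC_right g_def)
    moreover have "cinner g (x - (p + \<alpha> *\<^sub>C g)) = 0"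
      using gp[OF p(1)]
      by (cases "g = 0") (auto simp: cinner_diff_right cinner_add_right cinner_scaleC_right \<alpha>_def cinner_self cinner.zero_left)
    ultimately show "cinner w (x - (p + \<alpha> *\<^sub>C g)) = 0"
      by (simp only: w' cinner_add_left[of "v + c *\<^sub>C q"] cinner_scaleC_left) simp
  qed
qed

text \<open>With \<open>p\<close> the projection of \<open>x\<close>, the vector
  \<open>x - p\<close> is orthogonal to every \<open>p - v\<close>, so its norm is at most that of
  \<open>x - v\<close>; arbitrarily good approximation forces \<open>x = p\<close>.\<close>

lemma cspan_closed:
  assumes F: "finite F" and appr: "\<And>e. e > 0 \<Longrightarrow> \<exists>v\<in>cspan F. norm (x - v) \<le> e"
  shows "x \<in> cspan F"
proof -
  obtain p where p: "p \<in> cspan F" "\<And>v. v \<in> cspan F \<Longrightarrow> cinner v (x - p) = 0"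
    using cspan_orthogonal_projection[OF F] by blast
  have "norm (x - p) \<le> e" if e: "e > 0" for e
  proof -
    obtain v where v: "v \<in> cspan F" "norm (x - v) \<le> e" using appr[OF e] by blast
    have "cinner (x - v) (x - p) = cinner ((x - p) + (p - v)) (x - p)" by simp
    also have "\<dots> = cinner (x - p) (x - p)"
      using p(2)[OF cspan_diff[OF p(1) v(1)]] by (simp only: cinner_add_left) simp
    finally have "(norm (x - p))\<^sup>2 \<le> norm (x - v) * norm (x - p)"
      using Cauchy_Schwarz_cinner[of "x - v" "x - p"] by (simp add: cinner_self norm_power)
    also have "\<dots> \<le> e * norm (x - p)" using v by (intro mult_right_mono) auto
    finally show ?thesis using e by (cases "x = p") (auto simp: power2_eq_square)
  qed
  then have "norm (x - p) \<le> 0" by (rule dense_ge)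
  then show ?thesis using p(1) by simp
qed

text \<open>The operators for which they and their adjoints have range in one fixed subspace form a
  C*-algebra. The adjoint condition is needed on generators too, since it concerns an independent
  range; closedness of finite-dimensional spans handles norm limits.\<close>

lemma fin_dim_range_cstar_gen:
  fixes S :: "('a::chilbert_space \<Rightarrow> 'a) set"
  assumes F: "finite F" and S: "S \<subseteq> Collect bdd_op"
    and range: "\<And>T h. T \<in> S \<Longrightarrow> T h \<in> cspan F \<and> adj T h \<in> cspan F"
  shows "fin_dim_range (cstar_gen S)"
proof -
  define B where "B = {T :: 'a \<Rightarrow> 'a. bdd_op T \<and> (\<forall>h. T h \<in> cspan F) \<and> (\<forall>h. adj T h \<in> cspan F)}"
  have "cstar_subalg B"
  proof (rule cstar_subalgI)
    show "(\<lambda>x. 0) \<in> B" by (simp add: B_def bdd_op_const_zero adj_zero cspan_zero)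
    fix S T c assume S: "S \<in> B" and T: "T \<in> B"
    show "op_add S T \<in> B"
      using S T by (simp add: B_def bdd_op_op_add adj_op_add) (simp add: op_add_def cspan_add)
    show "S \<circ> T \<in> B" using S T by (simp add: B_def bdd_op_comp adj_comp)
    show "op_scale c T \<in> B"
      using T by (simp add: B_def bdd_op_op_scale adj_op_scale) (simp add: op_scale_def cspan_scale)
    show "adj T \<in> B" using T by (simp add: B_def bdd_op_adj adj_adj)
  next
    fix T assume T: "bdd_op T" and appr: "\<And>e. e > 0 \<Longrightarrow> \<exists>S\<in>B. \<forall>x. norm (T x - S x) \<le> e * norm x"
    have "T h \<in> cspan F \<and> adj T h \<in> cspan F" for h
    proof -
      have "\<exists>S\<in>B. norm (T h - S h) \<le> e \<and> norm (adj T h - adj S h) \<le> e" if e: "e > 0" for e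
      proof -
        define d where "d = e / (norm h + 1)"
        have n: "norm h + 1 > 0" by (simp add: add_nonneg_pos)
        have dh: "d * norm h \<le> e" using n e by (simp add: d_def field_simps)
        have "d > 0" using e n by (simp add: d_def)
        then obtain S where S: "S \<in> B" "\<And>x. norm (T x - S x) \<le> d * norm x" using appr by blast
        then have "norm (adj T h - adj S h) \<le> d * norm h"
          using adj_diff_le[OF _ T S(2)] by (auto simp: B_def)
        then show ?thesis using S dh by (meson order_trans)
      qed
      then show ?thesis unfolding B_def by (auto intro!: cspan_closed[OF F] dest: spec) blast+
    qed
    then show "T \<in> B" using T by (simp add: B_def)
  qed (auto simp: B_def)
  then have "cstar_gen S \<subseteq> B"
    by (rule cstar_gen_least) (use S range in \<open>auto simp: B_def\<close>)
  then show ?thesis unfolding fin_dim_range_def B_def using F by blast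
qed

section \<open>The correspondence of approximations\<close>

lemma representation_comp_star_rep:
  fixes C :: "('m::chilbert_space \<Rightarrow> 'm) set" and p :: "('m \<Rightarrow> 'm) \<Rightarrow> 'h::chilbert_space \<Rightarrow> 'h"
  assumes \<mu>: "compl_isometric_rep A \<mu>" "\<mu> ` A \<subseteq> C"
    and C: "cstar_subalg C" and p: "star_rep C p"
  shows "representation A (\<lambda>T. p (\<mu> T))"
proof -
  have \<mu>C: "\<mu> T \<in> C" if "T \<in> A" for T using that \<mu>(2) by blast
  have \<mu>hom: "alg_hom A \<mu>" using \<mu>(1) by (simp add: compl_isometric_rep_def)
  note hom = star_rep_alg_hom[OF p]
  have "alg_hom A (\<lambda>T. p (\<mu> T))"
    unfolding alg_hom_def
    by (simp add: \<mu>C alg_hom_add[OF \<mu>hom] alg_hom_comp[OF \<mu>hom] alg_hom_scale[OF \<mu>hom]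
        alg_hom_add[OF hom] alg_hom_comp[OF hom] alg_hom_scale[OF hom])
  moreover have "mat_norm n (\<lambda>i j. p (\<mu> (M i j))) \<le> mat_norm n M"
    if M: "\<forall>i<n. \<forall>j<n. M i j \<in> A" for n M
  proof -
    have "mat_norm n (\<lambda>i j. p (\<mu> (M i j))) \<le> mat_norm n (\<lambda>i j. \<mu> (M i j))"
      by (rule star_rep_mat_norm_le[OF C p]) (use M \<mu>C in auto)
    also have "\<dots> = mat_norm n M" using \<mu>(1) M by (simp add: compl_isometric_rep_def)
    finally show ?thesis .
  qed
  ultimately show ?thesis by (simp add: representation_def star_rep_bdd[OF p] \<mu>C)
qed

lemma star_RFD_imp_RFD_star_rep:
  fixes A :: "('k::chilbert_space \<Rightarrow> 'k) set" and C :: "('m::chilbert_space \<Rightarrow> 'm) set"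
    and \<rho> :: "('k \<Rightarrow> 'k) \<Rightarrow> 'h::chilbert_space \<Rightarrow> 'h"
  assumes cover: "max_cstar_cover A C \<mu> TYPE('h)" and \<theta>: "star_rep C \<theta>"
    and \<theta>\<mu>: "\<forall>T\<in>A. \<theta> (\<mu> T) = \<rho> T" and RFD: "star_RFD A \<rho>"
  shows "RFD_star_rep C \<theta>"
proof -
  have Cdef: "C = cstar_gen (\<mu> ` A)" and \<mu>b: "\<mu> ` A \<subseteq> Collect bdd_op"
    and lift: "\<And>r :: ('k \<Rightarrow> 'k) \<Rightarrow> 'h \<Rightarrow> 'h. representation A r \<Longrightarrow>
      \<exists>t. star_rep C t \<and> (\<forall>T\<in>A. t (\<mu> T) = r T)"
    using cover by (auto simp: max_cstar_cover_def compl_isometric_rep_def)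
  have C: "cstar_subalg C" unfolding Cdef by (rule cstar_subalg_cstar_gen[OF \<mu>b])
  have \<mu>C: "\<mu> T \<in> C" if "T \<in> A" for T using that cstar_gen_superset[of "\<mu> ` A"] Cdef by blast
  obtain F where F: "F \<noteq> bot"
    and ev: "eventually (\<lambda>r. representation A r \<and> fin_dim_range (cstar_gen (r ` A))) F"
    and lim: "\<And>T h. T \<in> A \<Longrightarrow> ((\<lambda>r. r T h) \<longlongrightarrow> \<rho> T h) F"
    and lim_adj: "\<And>T h. T \<in> A \<Longrightarrow> ((\<lambda>r. adj (r T) h) \<longlongrightarrow> adj (\<rho> T) h) F"
    using RFD unfolding star_RFD_def by blast
  \<comment> \<open>Off the representations \<open>L r\<close> is an arbitrary map. The net consists
    of representations only eventually, which is why its properties are drawn through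
    \<open>ev\<close>.\<close>
  define L :: "(('k \<Rightarrow> 'k) \<Rightarrow> 'h \<Rightarrow> 'h) \<Rightarrow> ('m \<Rightarrow> 'm) \<Rightarrow> 'h \<Rightarrow> 'h"
    where "L r = (SOME t. star_rep C t \<and> (\<forall>T\<in>A. t (\<mu> T) = r T))" for r
  have L: "star_rep C (L r)" "\<And>T. T \<in> A \<Longrightarrow> L r (\<mu> T) = r T" if "representation A r" for r
    using someI_ex[OF lift[OF that]] unfolding L_def by blast+
  have fin: "fin_dim_range (L r ` C)" if r: "representation A r" "fin_dim_range (cstar_gen (r ` A))" for r
  proof -
    have "r ` A \<subseteq> Collect bdd_op" using r(1) by (auto simp: representation_def)
    then have "L r ` C \<subseteq> cstar_gen (r ` A)"
      using L[OF r(1)] cstar_gen_superset[of "r ` A"] unfolding Cdef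
      by (intro star_rep_image_cstar_gen \<mu>b cstar_subalg_cstar_gen) auto
    then show ?thesis using r(2) unfolding fin_dim_range_def by blast
  qed
  have evL: "\<forall>\<^sub>F r in F. star_rep C (L r)" using ev by eventually_elim (simp add: L)
  have "C \<subseteq> {T \<in> C. \<forall>h. ((\<lambda>r. L r T h) \<longlongrightarrow> \<theta> T h) F \<and> ((\<lambda>r. L r (adj T) h) \<longlongrightarrow> \<theta> (adj T) h) F}"
    (is "C \<subseteq> ?B")
  proof -
    have "\<mu> T \<in> ?B" if T: "T \<in> A" for T
    proof -
      have "((\<lambda>r. L r (\<mu> T) h) \<longlongrightarrow> \<theta> (\<mu> T) h) F" for h
      proof (rule Lim_transform_eventually)
        show "((\<lambda>r. r T h) \<longlongrightarrow> \<theta> (\<mu> T) h) F" using lim[OF T] \<theta>\<mu> T by simp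
        show "\<forall>\<^sub>F r in F. r T h = L r (\<mu> T) h" using ev by eventually_elim (simp add: L T)
      qed
      moreover have "((\<lambda>r. L r (adj (\<mu> T)) h) \<longlongrightarrow> \<theta> (adj (\<mu> T)) h) F" for h
      proof (rule Lim_transform_eventually)
        show "((\<lambda>r. adj (r T) h) \<longlongrightarrow> \<theta> (adj (\<mu> T)) h) F"
          using lim_adj[OF T] \<theta>\<mu> T star_rep_adj[OF \<theta> \<mu>C[OF T]] by simp
        show "\<forall>\<^sub>F r in F. adj (r T) h = L r (adj (\<mu> T)) h"
          using ev by eventually_elim (simp add: L T star_rep_adj[OF _ \<mu>C])
      qed
      ultimately show ?thesis using \<mu>C[OF T] by simp
    qed
    then have "cstar_gen (\<mu> ` A) \<subseteq> ?B"
      by (intro cstar_gen_least cstar_subalg_strong_limit[OF C \<theta> evL]) blast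
    then show ?thesis using Cdef by simp
  qed
  then have conv: "((\<lambda>r. L r T h) \<longlongrightarrow> \<theta> T h) F" if "T \<in> C" for T h using that by blast
  show ?thesis
    unfolding RFD_star_rep_def
  \<comment> \<open>The lifted net keeps its indexing: pushing the filter forward along
    \<open>L\<close> turns limits over lifts into limits over the original maps.\<close>
  proof (intro exI[of _ "filtermap L F"] conjI ballI allI)
    show "filtermap L F \<noteq> bot" using F by (simp add: filtermap_bot_iff)
    show "\<forall>\<^sub>F p in filtermap L F. star_rep C p \<and> fin_dim_range (p ` C)"
      unfolding eventually_filtermap using ev by eventually_elim (simp add: L fin)
    show "((\<lambda>p. p T h) \<longlongrightarrow> \<theta> T h) (filtermap L F)" if "T \<in> C" for T h
      unfolding filterlim_filtermap by (rule conv[OF that])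
  qed
qed

text \<open>Strong convergence on \<open>C\<close> alone suffices: \<open>C\<close> contains
  \<open>adj (\<mu> T)\<close>, and *-representations carry it to the adjoint of the restriction at
  \<open>T\<close>.\<close>

lemma RFD_star_rep_imp_star_RFD:
  fixes A :: "('k::chilbert_space \<Rightarrow> 'k) set" and C :: "('m::chilbert_space \<Rightarrow> 'm) set"
    and \<rho> :: "('k \<Rightarrow> 'k) \<Rightarrow> 'h::chilbert_space \<Rightarrow> 'h"
  assumes \<mu>: "compl_isometric_rep A \<mu>" and Cdef: "C = cstar_gen (\<mu> ` A)"
    and \<theta>: "star_rep C \<theta>" and \<theta>\<mu>: "\<forall>T\<in>A. \<theta> (\<mu> T) = \<rho> T" and RFD: "RFD_star_rep C \<theta>"
  shows "star_RFD A \<rho>"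
proof -
  have \<mu>b: "\<mu> ` A \<subseteq> Collect bdd_op" using \<mu> by (auto simp: compl_isometric_rep_def)
  have C: "cstar_subalg C" unfolding Cdef by (rule cstar_subalg_cstar_gen[OF \<mu>b])
  have sub: "\<mu> ` A \<subseteq> C" unfolding Cdef by (rule cstar_gen_superset)
  then have \<mu>C: "\<mu> T \<in> C" if "T \<in> A" for T using that by blast
  obtain F where F: "F \<noteq> bot"
    and ev: "eventually (\<lambda>p. star_rep C p \<and> fin_dim_range (p ` C)) F"
    and lim: "\<And>T h. T \<in> C \<Longrightarrow> ((\<lambda>p. p T h) \<longlongrightarrow> \<theta> T h) F"
    using RFD unfolding RFD_star_rep_def by blast
  define R :: "(('m \<Rightarrow> 'm) \<Rightarrow> 'h \<Rightarrow> 'h) \<Rightarrow> ('k \<Rightarrow> 'k) \<Rightarrow> 'h \<Rightarrow> 'h"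
    where "R p = (\<lambda>T. p (\<mu> T))" for p
  have fin: "fin_dim_range (cstar_gen (R p ` A))" if p: "star_rep C p" "fin_dim_range (p ` C)" for p
  proof -
    obtain E where E: "finite E" "\<And>T h. T \<in> C \<Longrightarrow> p T h \<in> cspan E"
      using p(2) unfolding fin_dim_range_def by blast
    show ?thesis
    proof (rule fin_dim_range_cstar_gen[OF E(1)])
      show "R p ` A \<subseteq> Collect bdd_op" using star_rep_bdd[OF p(1) \<mu>C] by (auto simp: R_def)
      fix T h assume "T \<in> R p ` A"
      then obtain S where S: "S \<in> A" "T = p (\<mu> S)" by (auto simp: R_def)
      \<comment> \<open>The adjoint of \<open>p (\<mu> S)\<close> is again a value of
        \<open>p\<close> on \<open>C\<close>, so the same finite set \<open>E\<close> captures both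
        ranges.\<close>
      then show "T h \<in> cspan E \<and> adj T h \<in> cspan E"
        using E(2)[OF \<mu>C[OF S(1)]] E(2)[OF cstar_subalg_adj[OF C \<mu>C[OF S(1)]]]
          star_rep_adj[OF p(1) \<mu>C[OF S(1)]] by simp
    qed
  qed
  show ?thesis
    unfolding star_RFD_def
  proof (intro exI[of _ "filtermap R F"] conjI ballI allI)
    show "filtermap R F \<noteq> bot" using F by (simp add: filtermap_bot_iff)
    show "\<forall>\<^sub>F r in filtermap R F. representation A r \<and> fin_dim_range (cstar_gen (r ` A))"
      unfolding eventually_filtermap using ev
    proof eventually_elim
      case (elim p)
      then show ?case
        using representation_comp_star_rep[OF \<mu> sub C, of p] fin[of p] by (simp add: R_def)
    qed
    fix T h assume T: "T \<in> A"
    show "((\<lambda>r. r T h) \<longlongrightarrow> \<rho> T h) (filtermap R F)"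
      unfolding filterlim_filtermap R_def using lim[OF \<mu>C[OF T]] \<theta>\<mu> T by simp
    show "((\<lambda>r. adj (r T) h) \<longlongrightarrow> adj (\<rho> T) h) (filtermap R F)"
      unfolding filterlim_filtermap
    proof (rule Lim_transform_eventually)
      show "((\<lambda>p. p (adj (\<mu> T)) h) \<longlongrightarrow> adj (\<rho> T) h) F"
        using lim[OF cstar_subalg_adj[OF C \<mu>C[OF T]], of h] star_rep_adj[OF \<theta> \<mu>C[OF T]] \<theta>\<mu> T by simp
      show "\<forall>\<^sub>F p in F. p (adj (\<mu> T)) h = adj (R p T) h"
        using ev by eventually_elim (simp add: R_def star_rep_adj[OF _ \<mu>C[OF T]])
    qed
  qed
qed

theorem theorem5p4:
  fixes A :: "('k::chilbert_space \<Rightarrow> 'k) set"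
    and C :: "('m::chilbert_space \<Rightarrow> 'm) set"
    and \<mu> :: "('k \<Rightarrow> 'k) \<Rightarrow> ('m \<Rightarrow> 'm)"
    and \<rho> :: "('k \<Rightarrow> 'k) \<Rightarrow> ('h::chilbert_space \<Rightarrow> 'h)"
    and \<theta> :: "('m \<Rightarrow> 'm) \<Rightarrow> ('h \<Rightarrow> 'h)"
  assumes "op_algebra A"
    and "max_cstar_cover A C \<mu> TYPE('h)"
    and "representation A \<rho>"
    and "star_rep C \<theta>"
    and "\<forall>T\<in>A. \<theta> (\<mu> T) = \<rho> T"
  shows "star_RFD A \<rho> \<longleftrightarrow> RFD_star_rep C \<theta>"
proof
  show "RFD_star_rep C \<theta>" if "star_RFD A \<rho>"
    by (rule star_RFD_imp_RFD_star_rep[OF assms(2,4,5) that])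
  have "compl_isometric_rep A \<mu>" "C = cstar_gen (\<mu> ` A)"
    using assms(2) by (auto simp: max_cstar_cover_def)
  then show "star_RFD A \<rho>" if "RFD_star_rep C \<theta>"
    using RFD_star_rep_imp_star_RFD[OF _ _ assms(4,5) that] by blast
qed

end
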